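(* Let $H=H^{(N)}$ be a sequence of hermitian $N\times N$ Wigner type matrices, with centered entries and matrix of variances $S_{xy}=S_{xy}^{(N)}=\mathbb{E}|H_{xy}|^2$. Assume that $S_{xy}\le C^*/N$ for some constant $C^*$, independent of $N$. Further, assume a finite moment condition on the matrix elements, i.e. that for any $q\in\mathbb{N}$ there is a constant $C_q$, independent of $N$, such that $$\max_{x,y,N}\mathbb{E}\big(\sqrt N|H_{xy}|\big)^q\le C_q.$$ Set $$z_j:=\limsup_{N\to\infty}\frac{\|[S^{(N)}]^j\|}{\|S^{(N)}\|^j}$$ and for any $J\in\mathbb{N}\cup\{\infty\}$ let $w_c(J)$ be the smallest positive root of $$\phi_J(w):=1-\frac{w}{2}\Big(1+\sum_{j=1}^J\Big(\frac{w}{2}\Big)^j z_j+\sum_{j>J}\Big(\frac{w}{2}\Big)^j\Big).$$ Then for any $\epsilon>0$ (small) and any $D>0$ (large) we have the following bound on the largest eigenvalue of $H$: $$\mathbb{P}\Big(|\lambda_{\max}(H^{(N)})|\ge 2\frac{\|S^{(N)}\|^{1/2}}{w_c(J)}+\epsilon\Big)\le C(\epsilon,D)N^{-D}$$ for some constant $C(\epsilon,D)$ depending only on $C^*$ and the sequence of constants $C_q$, in addition to $\epsilon$ and $D$.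
   Context: A Wigner type matrix is a random hermitian matrix $H=H^*$ whose entries $H_{xy}$ are independent up to the symmetry constraint $H=H^*$, but whose distributions may vary within the matrix; centered means $\mathbb{E}H_{xy}=0$. $\lambda_{\max}(H)$ denotes the largest eigenvalue of $H$. For a matrix $M$, $\|M\|:=\max_x\sum_y|M_{xy}|$ denotes the matrix norm induced by the maximum norm on $\mathbb{C}^N$. For $J=\infty$ the last sum in $\phi_J$ is empty.
   Formalization: The bound is stated only for N ≥ N₀, where N₀ depends on the sequence of variance matrices S and on ε; for all N with C(ε,D) independent of the sequence the claim fails, since z_j is a limsup and ignores finitely many N. *)

theory Defs
  imports
    "HOL-Probability.Probability"
    "HOL-Library.Extended_Nat"
    "Jordan_Normal_Form.Schur_Decomposition"
begin

(* Independence up to the symmetry constraint: the entries on and above the diagonal are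
   independent (as complex random variables; nothing is assumed about their real and
   imaginary parts). *)
definition wigner_type :: "'a measure \<Rightarrow> nat \<Rightarrow> ('a \<Rightarrow> complex mat) \<Rightarrow> bool" where
  "wigner_type M N H \<longleftrightarrow>
     prob_space M \<and>
     (\<forall>\<omega>\<in>space M. H \<omega> \<in> carrier_mat N N \<and> mat_adjoint (H \<omega>) = H \<omega>) \<and>
     prob_space.indep_vars M (\<lambda>_. borel) (\<lambda>(x, y) \<omega>. H \<omega> $$ (x, y)) {(x, y). x \<le> y \<and> y < N}"

definition centered :: "'a measure \<Rightarrow> nat \<Rightarrow> ('a \<Rightarrow> complex mat) \<Rightarrow> bool" where
  "centered M N H \<longleftrightarrow>
     (\<forall>x<N. \<forall>y<N. integrable M (\<lambda>\<omega>. H \<omega> $$ (x, y)) \<and> (\<integral>\<omega>. H \<omega> $$ (x, y) \<partial>M) = 0)"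

definition variance_mat :: "'a measure \<Rightarrow> nat \<Rightarrow> ('a \<Rightarrow> complex mat) \<Rightarrow> real mat" where
  "variance_mat M N H = mat N N (\<lambda>(x, y). \<integral>\<omega>. (cmod (H \<omega> $$ (x, y)))\<^sup>2 \<partial>M)"

(* Integrability is required explicitly because the Bochner integral of a non-integrable
   function is 0. *)
definition moment_bounds :: "'a measure \<Rightarrow> nat \<Rightarrow> ('a \<Rightarrow> complex mat) \<Rightarrow> (nat \<Rightarrow> real) \<Rightarrow> bool" where
  "moment_bounds M N H Cq \<longleftrightarrow>
     (\<forall>q. \<forall>x<N. \<forall>y<N.
        integrable M (\<lambda>\<omega>. (sqrt (real N) * cmod (H \<omega> $$ (x, y))) ^ q) \<and>
        (\<integral>\<omega>. (sqrt (real N) * cmod (H \<omega> $$ (x, y))) ^ q \<partial>M) \<le> Cq q)"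

(* Meaningful for hermitian matrices of positive dimension, all of whose eigenvalues are real. *)
definition lambda_max :: "complex mat \<Rightarrow> real" where
  "lambda_max A = Max {r::real. eigenvalue A (complex_of_real r)}"

definition row_norm :: "real mat \<Rightarrow> real" where
  "row_norm A = Max ((\<lambda>x. \<Sum>y<dim_col A. \<bar>A $$ (x, y)\<bar>) ` {..<dim_row A})"

(* For N > 0 the quotients lie in [0, 1], because the norm is submultiplicative and 0 / 0 = 0,
   so the limit superior is finite. *)
definition zcoef :: "(nat \<Rightarrow> real mat) \<Rightarrow> nat \<Rightarrow> real" where
  "zcoef S j = real_of_ereal
     (limsup (\<lambda>N. ereal (row_norm (S N ^\<^sub>m j) / row_norm (S N) ^ j)))"

definition phi :: "(nat \<Rightarrow> real) \<Rightarrow> enat \<Rightarrow> real \<Rightarrow> real" where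
  "phi z J w = 1 - w / 2 * (1 + (\<Sum>\<^sub>\<infinity>j\<in>{j. 1 \<le> j \<and> enat j \<le> J}. (w / 2) ^ j * z j)
                              + (\<Sum>\<^sub>\<infinity>j\<in>{j. J < enat j}. (w / 2) ^ j))"

(* For 0 \<le> z j \<le> 1 both series converge on 0 < w < 2.  The smallest positive root lies there,
   except when J = \<infinity> and all z j with j > 0 vanish, where phi is 1 - w / 2 and the root is 2.
   So the value 0 that the infinite sum takes on divergent series never matters. *)
definition w_c :: "(nat \<Rightarrow> real) \<Rightarrow> enat \<Rightarrow> real" where
  "w_c z J = (LEAST w. 0 < w \<and> phi z J w = 0)"

end

theory Submission
  imports Defs "Jordan_Normal_Form.Spectral_Radius" "HOL-Real_Asymp.Real_Asymp"
begin

text \<open>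
  The proof is a moment method at order \<open>log N\<close>.  Entries are truncated at \<open>N^(-1/4)\<close>, which by the
  moment assumption changes the matrix with negligible probability and leaves entries that are
  centered up to an error of order \<open>N^(-5/2)\<close>.  The trace of the power \<open>2k\<close> of the truncated matrix is a sum over
  closed walks, and the expectation of each product is bounded by independence.  To leading order only walks count
  that explore a tree depth first, using each edge twice; their total weight is a sum over
  Dyck paths weighted by \<open>S\<close>, hence governed by the solution of the Dyson equation.

  Two observations carry the proof.  The first is that an explicit supersolution of the Dyson equation
  exists.  With \<open>\<sigma>\<^sup>2 = \<parallel>S\<parallel>\<close>, the resolvent vector \<open>r = \<Sum>j. s^j (S / \<sigma>\<^sup>2)^j 1\<close> satisfies
  \<open>r \<ge> 1 + (s\<^sup>2 / \<sigma>\<^sup>2) r (S r)\<close> whenever \<open>s r \<le> 1\<close>, and since \<open>r \<le> \<Sum>j. s^j \<parallel>S^j\<parallel> / \<parallel>S\<parallel>^j\<close>, the condition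
  \<open>s r \<le> 1\<close> holds for large \<open>N\<close> as soon as \<open>\<phi> (2 s) > 0\<close>, that is, for all \<open>s < w_c / 2\<close>
  (\<open>dyson_supersolution\<close>, \<open>w_c_characterization\<close>, \<open>eventually_supersolution\<close>).  The growth rate of the
  weighted Dyck paths is then at most \<open>\<sigma> / s\<close> per step.

  The second is that the walks need not be classified.  To every walk a potential is attached, a product
  over the vertices of a factor that depends only on the number of edges at the vertex that have
  been used exactly once.  On depth first explorations the potential is the product of \<open>r\<close> over the active
  path, and the supersolution property says that weight times potential, summed over the next step,
  grows by at most the factor \<open>\<sigma> / s\<close>.  Steps that no such exploration makes
  multiply the potential by at most a power of \<open>k\<close>, but carry a negative power of \<open>N\<close>, so a
  slight strengthening of the supersolution property absorbs them
  (\<open>sum_potential_step\<close>, \<open>sum_walk_weight_le\<close>).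

  Markov's inequality for the trace then gives the bound with threshold
  \<open>\<sigma> / s + \<epsilon>\<close> (\<open>lambda_max_tail_bound\<close>, \<open>lambda_max_tail_uniform\<close>).  The best \<open>s\<close> belongs to \<open>J = \<infinity>\<close>, because
  \<open>w_c\<close> is largest there (\<open>w_c_le_w_c_infinity\<close>), and so one threshold for \<open>N\<close> serves all \<open>J\<close>.
\<close>

section \<open>Row norms and a supersolution of the Dyson equation\<close>

lemma row_norm_ge:
  assumes "A \<in> carrier_mat N N" "x < N"
  shows "(\<Sum>y<N. \<bar>A $$ (x, y)\<bar>) \<le> row_norm A"
  using assms unfolding row_norm_def by (intro Max_ge) auto

lemma row_norm_le:
  assumes "A \<in> carrier_mat N N" "0 < N" "\<And>x. x < N \<Longrightarrow> (\<Sum>y<N. \<bar>A $$ (x, y)\<bar>) \<le> c"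
  shows "row_norm A \<le> c"
  using assms unfolding row_norm_def by (subst Max_le_iff) auto

lemma row_norm_nonneg:
  assumes "A \<in> carrier_mat N N" "0 < N"
  shows "0 \<le> row_norm A"
  using row_norm_ge[OF assms] by (rule order_trans[rotated]) (auto intro: sum_nonneg)

lemma row_norm_mult:
  assumes A: "A \<in> carrier_mat N N" and B: "B \<in> carrier_mat N N" and N: "0 < N"
  shows "row_norm (A * B) \<le> row_norm A * row_norm B"
proof (rule row_norm_le[OF _ N])
  show "A * B \<in> carrier_mat N N" using A B by simp
  fix x assume x: "x < N"
  have "(\<Sum>y<N. \<bar>(A * B) $$ (x, y)\<bar>) = (\<Sum>y<N. \<bar>\<Sum>z<N. A $$ (x, z) * B $$ (z, y)\<bar>)"
    using A B x by (intro sum.cong) (auto simp: scalar_prod_def atLeast0LessThan)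
  also have "\<dots> \<le> (\<Sum>y<N. \<Sum>z<N. \<bar>A $$ (x, z)\<bar> * \<bar>B $$ (z, y)\<bar>)"
    by (intro sum_mono) (metis (mono_tags, lifting) sum_abs sum.cong abs_mult)
  also have "\<dots> = (\<Sum>z<N. \<bar>A $$ (x, z)\<bar> * (\<Sum>y<N. \<bar>B $$ (z, y)\<bar>))"
    by (subst sum.swap) (simp add: sum_distrib_left)
  also have "\<dots> \<le> (\<Sum>z<N. \<bar>A $$ (x, z)\<bar> * row_norm B)"
    using row_norm_ge[OF B] by (intro sum_mono mult_left_mono) auto
  also have "\<dots> \<le> row_norm A * row_norm B"
    using row_norm_ge[OF A x] row_norm_nonneg[OF B N]
    by (simp add: sum_distrib_right[symmetric] mult_right_mono)
  finally show "(\<Sum>y<N. \<bar>(A * B) $$ (x, y)\<bar>) \<le> row_norm A * row_norm B" .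
qed

lemma row_norm_pow:
  assumes A: "A \<in> carrier_mat N N" and N: "0 < N"
  shows "row_norm (A ^\<^sub>m j) \<le> row_norm A ^ j"
proof (induction j)
  case 0
  have "row_norm (1\<^sub>m N) \<le> 1"
    by (rule row_norm_le[OF _ N]) (auto simp: if_distrib[of abs] sum.delta cong: if_cong)
  then show ?case using A by simp
next
  case (Suc j)
  have "row_norm (A ^\<^sub>m Suc j) \<le> row_norm (A ^\<^sub>m j) * row_norm A"
    using row_norm_mult[OF _ A N] A by simp
  also have "\<dots> \<le> row_norm A ^ j * row_norm A"
    using Suc row_norm_nonneg[OF A N] by (rule mult_right_mono)
  finally show ?case by (simp add: mult.commute)
qed

lemma row_norm_pow_quotient:
  assumes A: "A \<in> carrier_mat N N" and N: "0 < N"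
  shows "0 \<le> row_norm (A ^\<^sub>m j) / row_norm A ^ j" "row_norm (A ^\<^sub>m j) / row_norm A ^ j \<le> 1"
proof -
  have "A ^\<^sub>m j \<in> carrier_mat N N" using A by simp
  then show "0 \<le> row_norm (A ^\<^sub>m j) / row_norm A ^ j"
    using row_norm_nonneg[OF _ N] A by auto
  show "row_norm (A ^\<^sub>m j) / row_norm A ^ j \<le> 1"
  proof (cases "row_norm A ^ j = 0")
    case False
    then have "0 < row_norm A ^ j" using row_norm_nonneg[OF A N] by (metis order_le_less zero_le_power)
    then show ?thesis using row_norm_pow[OF A N, of j] by (simp only: divide_le_eq_1_pos)
  next
    case True
    then show ?thesis by (simp only: div_by_0 zero_le_one)
  qed
qed

text \<open>
  \<^term>\<open>pow_mat\<close> multiplies on the right; the recursion for row sums of powers needs the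
  new factor on the left.
\<close>
lemma pow_mat_commute:
  assumes "A \<in> carrier_mat N N"
  shows "(A :: real mat) * A ^\<^sub>m j = A ^\<^sub>m j * A"
proof (induction j)
  case 0
  then show ?case using assms by simp
next
  case (Suc j)
  have "A * A ^\<^sub>m Suc j = (A * A ^\<^sub>m j) * A"
    using assms by (simp add: assoc_mult_mat[of _ N N _ N _ N])
  then show ?case by (simp add: Suc)
qed

text \<open>
  The generating function of Dyck paths (plane trees) whose steps away from the root are weighted
  by \<open>S\<close> and by \<open>s\<^sup>2 / \<sigma>\<^sup>2\<close> per edge, with \<open>\<sigma>\<^sup>2 = \<parallel>S\<parallel>\<close>, is the minimal solution of
  \<open>u = 1 + (s\<^sup>2 / \<sigma>\<^sup>2) u (S u)\<close>, which is, up to scaling, the Dyson equation at a real point.  It is finite as soon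
  as there is a bounded supersolution, and the resolvent vector \<open>r = \<Sum>j. (s S / \<sigma>\<^sup>2)^j 1\<close> is one:
  from \<open>r = 1 + s S r / \<sigma>\<^sup>2\<close> the inequality
  \<open>r \<ge> 1 + (s\<^sup>2 / \<sigma>\<^sup>2) r (S r)\<close> is the same as \<open>s r (r - 1) \<le> r - 1\<close>, so it holds when \<open>s r \<le> 1\<close>.
  As row sums of \<open>S^j\<close> are at most \<open>\<parallel>S^j\<parallel>\<close>, the latter follows from
  \<open>s \<Sum>j. s^j \<parallel>S^j\<parallel> / \<parallel>S\<parallel>^j \<le> 1\<close>, which is where the function \<open>\<phi>\<close> comes from.
  The series is cut at \<open>J\<close>, with the geometric series as tail, because only finitely many of the
  quotients are under control for a given large \<open>N\<close>.
\<close>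
lemma dyson_supersolution:
  assumes S: "S \<in> carrier_mat N N" and N: "0 < N"
    and S0: "\<And>x y. x < N \<Longrightarrow> y < N \<Longrightarrow> 0 \<le> S $$ (x, y)"
    and s: "0 < s" "s < 1"
    and R: "s * ((\<Sum>j<J. s ^ j * (row_norm (S ^\<^sub>m j) / row_norm S ^ j)) + s ^ J / (1 - s)) \<le> 1"
  obtains r where "\<And>x. x < N \<Longrightarrow> 1 \<le> r x" "\<And>x. x < N \<Longrightarrow> r x \<le> 1 / s"
    "\<And>x. x < N \<Longrightarrow> s\<^sup>2 * (\<Sum>y<N. S $$ (x, y) * r y) \<le> row_norm S * (1 - 1 / r x)"
proof (cases "row_norm S = 0")
  case True
  have "S $$ (x, y) = 0" if "x < N" "y < N" for x y
  proof -
    have "(\<Sum>y<N. \<bar>S $$ (x, y)\<bar>) = 0"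
      using row_norm_ge[OF S that(1)] True by (intro antisym) (auto intro: sum_nonneg)
    then show ?thesis using that by (auto simp: sum_nonneg_eq_0_iff)
  qed
  then show ?thesis using that[of "\<lambda>_. 1"] s True by auto
next
  case False
  define \<sigma> where "\<sigma> = row_norm S"
  have \<sigma>: "0 < \<sigma>" using False row_norm_nonneg[OF S N] by (simp add: \<sigma>_def)
  define P where "P j x = (\<Sum>z<N. (S ^\<^sub>m j) $$ (x, z)) / \<sigma> ^ j" for j x
  define c where "c = s ^ J / (1 - s)"
  define r where "r x = (\<Sum>j<J. s ^ j * P j x) + c" for x
  have Sj: "S ^\<^sub>m j \<in> carrier_mat N N" for j using S by simp
  have P0: "P 0 x = 1" if "x < N" for x using S that by (simp add: P_def)
  have P_le: "P j x \<le> row_norm (S ^\<^sub>m j) / \<sigma> ^ j" if "x < N" for j x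
  proof -
    have "(\<Sum>z<N. (S ^\<^sub>m j) $$ (x, z)) \<le> (\<Sum>z<N. \<bar>(S ^\<^sub>m j) $$ (x, z)\<bar>)" by (intro sum_mono) simp
    also have "\<dots> \<le> row_norm (S ^\<^sub>m j)" by (rule row_norm_ge[OF Sj that])
    finally show ?thesis unfolding P_def using \<sigma> by (simp add: divide_right_mono)
  qed
  have P_Suc: "(\<Sum>y<N. S $$ (x, y) * P j y) = \<sigma> * P (Suc j) x" if "x < N" for j x
  proof -
    have "(\<Sum>z<N. (S ^\<^sub>m Suc j) $$ (x, z)) = (\<Sum>z<N. (S * S ^\<^sub>m j) $$ (x, z))"
      using pow_mat_commute[OF S] by simp
    also have "\<dots> = (\<Sum>z<N. \<Sum>y<N. S $$ (x, y) * (S ^\<^sub>m j) $$ (y, z))"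
      using S Sj[of j] that by (intro sum.cong) (auto simp: scalar_prod_def atLeast0LessThan)
    also have "\<dots> = (\<Sum>y<N. S $$ (x, y) * (\<Sum>z<N. (S ^\<^sub>m j) $$ (y, z)))"
      by (subst sum.swap) (simp add: sum_distrib_left)
    finally show ?thesis using \<sigma> by (simp add: P_def sum_divide_distrib[symmetric])
  qed
  have PJ: "P J x \<le> 1" if "x < N" for x
    using P_le[OF that, of J] row_norm_pow_quotient(2)[OF S N, of J] by (simp add: \<sigma>_def)
  have c: "0 \<le> c" "c * (1 - s) = s ^ J" using s by (auto simp: c_def)
  have main: "s * (\<Sum>y<N. S $$ (x, y) * r y) \<le> \<sigma> * (r x - 1)" if x: "x < N" for x
  proof -
    have row: "(\<Sum>y<N. S $$ (x, y)) \<le> \<sigma>"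
    proof -
      have "(\<Sum>y<N. S $$ (x, y)) \<le> (\<Sum>y<N. \<bar>S $$ (x, y)\<bar>)" by (intro sum_mono) simp
      then show ?thesis using row_norm_ge[OF S x] by (simp add: \<sigma>_def)
    qed
    have "(\<Sum>y<N. S $$ (x, y) * r y)
        = (\<Sum>y<N. \<Sum>j<J. s ^ j * (S $$ (x, y) * P j y)) + (\<Sum>y<N. S $$ (x, y)) * c"
      by (simp add: r_def distrib_left sum.distrib sum_distrib_left sum_distrib_right mult_ac)
    also have "(\<Sum>y<N. \<Sum>j<J. s ^ j * (S $$ (x, y) * P j y)) = (\<Sum>j<J. s ^ j * (\<sigma> * P (Suc j) x))"
      by (subst sum.swap) (simp add: sum_distrib_left[symmetric] P_Suc[OF x])
    finally have "s * (\<Sum>y<N. S $$ (x, y) * r y)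
        = \<sigma> * (\<Sum>j<J. s ^ Suc j * P (Suc j) x) + s * c * (\<Sum>y<N. S $$ (x, y))"
      by (simp add: distrib_left sum_distrib_left mult_ac)
    also have "(\<Sum>j<J. s ^ Suc j * P (Suc j) x) = (\<Sum>j<J. s ^ j * P j x) + s ^ J * P J x - 1"
      using sum.lessThan_Suc_shift[of "\<lambda>j. s ^ j * P j x" J] P0[OF x] by simp
    also have "\<sigma> * \<dots> + s * c * (\<Sum>y<N. S $$ (x, y))
        \<le> \<sigma> * ((\<Sum>j<J. s ^ j * P j x) + s ^ J * 1 - 1) + s * c * \<sigma>"
      using \<sigma> s c PJ[OF x] row by (intro add_mono mult_left_mono diff_mono) auto
    also have "\<dots> = \<sigma> * (r x - 1)"
    proof -
      have eq: "s ^ J = c - c * s" using c(2) by (simp add: algebra_simps)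
      show ?thesis unfolding r_def eq by (simp add: algebra_simps)
    qed
    finally show ?thesis .
  qed
  have P_ge: "0 \<le> P j x" if "x < N" for j x
    using that
  proof (induction j arbitrary: x)
    case 0 then show ?case using P0 by simp
  next
    case (Suc j)
    have "0 \<le> \<sigma> * P (Suc j) x"
      using Suc S0 unfolding P_Suc[OF Suc.prems, symmetric] by (intro sum_nonneg mult_nonneg_nonneg) auto
    then show ?case using \<sigma> by (simp add: zero_le_mult_iff)
  qed
  have r0: "0 \<le> r x" if "x < N" for x
    unfolding r_def using P_ge that s c by (intro add_nonneg_nonneg sum_nonneg mult_nonneg_nonneg) auto
  have r1: "1 \<le> r x" if "x < N" for x
  proof -
    have "0 \<le> s * (\<Sum>y<N. S $$ (x, y) * r y)"
      using S0 r0 that s by (intro mult_nonneg_nonneg sum_nonneg) auto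
    then have "0 \<le> \<sigma> * (r x - 1)" using main[OF that] by linarith
    then show ?thesis using \<sigma> by (simp add: zero_le_mult_iff)
  qed
  have rs: "s * r x \<le> 1" if "x < N" for x
  proof -
    have "r x \<le> (\<Sum>j<J. s ^ j * (row_norm (S ^\<^sub>m j) / row_norm S ^ j)) + s ^ J / (1 - s)"
      unfolding r_def c_def using P_le[OF that] s \<sigma>_def
      by (intro add_mono sum_mono mult_left_mono) auto
    then show ?thesis using R s by (meson mult_left_mono order_trans less_imp_le)
  qed
  show ?thesis
  proof (rule that[of r])
    fix x assume x: "x < N"
    show "1 \<le> r x" by (rule r1[OF x])
    show "r x \<le> 1 / s" using rs[OF x] s by (simp add: field_simps)
    have "s\<^sup>2 * (\<Sum>y<N. S $$ (x, y) * r y) \<le> s * (\<sigma> * (r x - 1))"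
      using main[OF x] s by (simp add: power2_eq_square mult.assoc)
    also have "s * (r x - 1) \<le> (r x - 1) / r x"
    proof -
      have "(s * r x) * (r x - 1) \<le> 1 * (r x - 1)"
        using rs[OF x] r1[OF x] by (intro mult_right_mono) auto
      then show ?thesis using r1[OF x] by (simp add: field_simps)
    qed
    then have "s * (\<sigma> * (r x - 1)) \<le> \<sigma> * (1 - 1 / r x)"
      using \<sigma> r1[OF x] by (simp add: diff_divide_distrib mult.left_commute mult_left_mono)
    finally show "s\<^sup>2 * (\<Sum>y<N. S $$ (x, y) * r y) \<le> row_norm S * (1 - 1 / r x)"
      by (simp add: \<sigma>_def)
  qed
qed

section \<open>The smallest positive root\<close>

text \<open>
  Written in \<open>s = w / 2\<close>, the function \<open>\<phi>\<close> is \<open>1 - s \<Sum>j. b j * s^j\<close> with \<open>b 0 = 1\<close>, \<open>b j = z j\<close> for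
  \<open>1 \<le> j \<le> J\<close> and \<open>b j = 1\<close> beyond.  A single power series is easier to compare for different \<open>J\<close>.
\<close>
definition root_coef :: "(nat \<Rightarrow> real) \<Rightarrow> enat \<Rightarrow> nat \<Rightarrow> real" where
  "root_coef z J j = (if j = 0 then 1 else if enat j \<le> J then z j else 1)"

definition root_series :: "(nat \<Rightarrow> real) \<Rightarrow> enat \<Rightarrow> real \<Rightarrow> real" where
  "root_series z J s = s * (\<Sum>j. root_coef z J j * s ^ j)"

context
  fixes z :: "nat \<Rightarrow> real"
  assumes z: "\<And>j. 0 \<le> z j" "\<And>j. z j \<le> 1"
begin

lemma root_coef_bounds: "0 \<le> root_coef z J j" "root_coef z J j \<le> 1"
  using z by (auto simp: root_coef_def)

lemma summable_root_coef:
  assumes "0 \<le> s" "s < 1"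
  shows "summable (\<lambda>j. root_coef z J j * s ^ j)"
proof (rule summable_comparison_test[OF _ summable_geometric[of s]])
  show "\<exists>N. \<forall>n\<ge>N. norm (root_coef z J n * s ^ n) \<le> s ^ n"
    using assms root_coef_bounds by (auto simp: abs_mult intro!: mult_left_le_one_le)
qed (use assms in auto)

lemma phi_eq_root_series:
  assumes "0 \<le> w" "w < 2"
  shows "phi z J w = 1 - root_series z J (w / 2)"
proof -
  define s where "s = w / 2"
  have s: "0 \<le> s" "s < 1" using assms by (auto simp: s_def)
  let ?a = "\<lambda>j. root_coef z J j * s ^ j"
  have nn: "\<And>j. 0 \<le> ?a j" using root_coef_bounds s by simp
  have sum: "?a summable_on A" for A
    using summable_on_subset_banach[OF summable_nonneg_imp_summable_on[OF summable_root_coef[OF s] nn]] by blast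
  have "(\<Sum>j. ?a j) = (\<Sum>\<^sub>\<infinity>j. ?a j)"
    
  proof -
    have "(?a has_sum (\<Sum>j. ?a j)) UNIV"
      using summable_root_coef[OF s, of J] nn by (intro norm_summable_imp_has_sum) (auto intro: summable_sums)
    then show ?thesis by (simp add: infsumI)
  qed
  also have U: "(UNIV :: nat set) = {0} \<union> ({j. 1 \<le> j \<and> enat j \<le> J} \<union> {j. J < enat j})"
    by (auto simp: Suc_le_eq)
  also have "infsum ?a ({0} \<union> ({j. 1 \<le> j \<and> enat j \<le> J} \<union> {j. J < enat j})) = infsum ?a {0} + infsum ?a ({j. 1 \<le> j \<and> enat j \<le> J} \<union> {j. J < enat j})"
    by (rule infsum_Un_disjoint[OF sum sum]) (auto simp: zero_enat_def[symmetric])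
  also have "infsum ?a ({j. 1 \<le> j \<and> enat j \<le> J} \<union> {j. J < enat j})
      = infsum ?a {j. 1 \<le> j \<and> enat j \<le> J} + infsum ?a {j. J < enat j}"
    by (rule infsum_Un_disjoint[OF sum sum]) auto
  also have "infsum ?a {j. 1 \<le> j \<and> enat j \<le> J} = (\<Sum>\<^sub>\<infinity>j\<in>{j. 1 \<le> j \<and> enat j \<le> J}. s ^ j * z j)"
    by (intro infsum_cong) (auto simp: root_coef_def)
  also have "infsum ?a {j. J < enat j} = (\<Sum>\<^sub>\<infinity>j\<in>{j. J < enat j}. s ^ j)"
    by (intro infsum_cong) (auto simp: root_coef_def)
  finally show ?thesis
    by (simp add: phi_def root_series_def s_def[symmetric] root_coef_def add.assoc)
qed

text \<open>
  This makes the positive root of \<open>\<phi>\<close> below 2 unique, and so the least one.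
\<close>
lemma root_series_strict_mono:
  assumes "0 \<le> s" "s < t" "t < 1"
  shows "root_series z J s < root_series z J t"
proof -
  have le: "(\<Sum>j. root_coef z J j * s ^ j) \<le> (\<Sum>j. root_coef z J j * t ^ j)"
    using assms root_coef_bounds
    by (intro suminf_le summable_root_coef mult_left_mono power_mono) auto
  have "(\<Sum>j<1. root_coef z J j * s ^ j) \<le> (\<Sum>j. root_coef z J j * s ^ j)"
    using assms root_coef_bounds by (intro sum_le_suminf summable_root_coef) auto
  then have pos: "0 < (\<Sum>j. root_coef z J j * s ^ j)" by (simp add: root_coef_def)
  have "root_series z J s < t * (\<Sum>j. root_coef z J j * s ^ j)"
    unfolding root_series_def using pos assms by (intro mult_strict_right_mono) auto
  also have "\<dots> \<le> root_series z J t"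
    unfolding root_series_def using le assms by (intro mult_left_mono) auto
  finally show ?thesis .
qed

lemma root_series_term_le:
  assumes "0 \<le> s" "s < 1" "0 < m"
  shows "s * (1 + root_coef z J m * s ^ m) \<le> root_series z J s"
proof -
  have "(\<Sum>j\<in>{0, m}. root_coef z J j * s ^ j) \<le> (\<Sum>j. root_coef z J j * s ^ j)"
    using assms root_coef_bounds by (intro sum_le_suminf summable_root_coef) auto
  then show ?thesis using assms by (simp add: root_series_def root_coef_def mult_left_mono)
qed

lemma root_series_le_geometric:
  assumes "0 \<le> s" "s < 1"
  shows "root_series z J s \<le> s / (1 - s)"
proof -
  have "(\<Sum>j. root_coef z J j * s ^ j) \<le> (\<Sum>j. s ^ j)"
    using assms root_coef_bounds
    by (intro suminf_le summable_root_coef summable_geometric mult_left_le_one_le) auto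
  then have "(\<Sum>j. root_coef z J j * s ^ j) \<le> 1 / (1 - s)"
    using assms suminf_geometric[of s] by simp
  then have "s * (\<Sum>j. root_coef z J j * s ^ j) \<le> s * (1 / (1 - s))"
    using assms by (intro mult_left_mono) auto
  then show ?thesis by (simp add: root_series_def)
qed

lemma continuous_root_series: "continuous_on {0..<1} (root_series z J)"
proof -
  have "isCont (root_series z J) s" if "s \<in> {0..<1}" for s
    unfolding root_series_def
  proof (intro continuous_intros isCont_powser)
    show "summable (\<lambda>n. root_coef z J n * ((1 + s) / 2) ^ n)"
      using that by (intro summable_root_coef) auto
    show "norm s < norm ((1 + s) / 2)" using that by auto
  qed
  then show ?thesis by (simp add: continuous_at_imp_continuous_on)
qed

text \<open>
  Either the series reaches 1 on \<open>(0, 1)\<close>, and \<open>w_c / 2\<close> is the point where it does, or it stays below 1.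
  In the second case letting \<open>s\<close> tend to 1 forces all \<open>b j\<close> with \<open>j > 0\<close> to vanish, so that \<open>J\<close> is infinite,
  \<open>\<phi>\<close> is \<open>1 - w / 2\<close> on the whole line, and \<open>w_c = 2\<close>.
\<close>
lemma w_c_characterization:
  "1 \<le> w_c z J \<and> w_c z J \<le> 2 \<and>
   (\<forall>t. 0 < t \<and> t < w_c z J / 2 \<longrightarrow> root_series z J t < 1) \<and>
   (\<forall>t. w_c z J / 2 < t \<and> t < 1 \<longrightarrow> 1 < root_series z J t)"
proof (cases "\<exists>t. 0 < t \<and> t < 1 \<and> 1 \<le> root_series z J t")
  case True
  then obtain t where t: "0 < t" "t < 1" "1 \<le> root_series z J t" by blast
  have "\<exists>s. 0 \<le> s \<and> s \<le> t \<and> root_series z J s = 1"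
  proof (rule IVT')
    show "root_series z J 0 \<le> 1" by (simp add: root_series_def)
    show "continuous_on {0..t} (root_series z J)"
      by (rule continuous_on_subset[OF continuous_root_series]) (use t in auto)
  qed (use t in auto)
  then obtain s where s: "0 \<le> s" "s \<le> t" "root_series z J s = 1" by blast
  have s0: "0 < s" "s < 1" using s t by (auto simp: root_series_def order_le_less)
  have half: "1 / 2 \<le> s"
    using root_series_le_geometric[of s J] s0 s by (simp add: field_simps)
  have "w_c z J = 2 * s"
    unfolding w_c_def
  proof (rule Least_equality)
    show "0 < 2 * s \<and> phi z J (2 * s) = 0" using s0 s phi_eq_root_series[of "2 * s" J] by simp
    fix w assume w: "0 < w \<and> phi z J w = 0"
    show "2 * s \<le> w"
    proof (rule ccontr)
      assume "\<not> 2 * s \<le> w"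
      then have "root_series z J (w / 2) < 1" "w < 2"
        using root_series_strict_mono[of "w / 2" s J] s s0 w by auto
      then show False using w phi_eq_root_series[of w J] by simp
    qed
  qed
  then show ?thesis
    using half s s0 root_series_strict_mono[of _ s J] root_series_strict_mono[of s _ J] by force
next
  case False
  have coef0: "root_coef z J m = 0" if "0 < m" for m
  proof -
    have "((\<lambda>s. s * (1 + root_coef z J m * s ^ m)) \<longlongrightarrow> 1 * (1 + root_coef z J m * 1 ^ m)) (at_left 1)"
      by (intro tendsto_intros)
    moreover have "\<forall>\<^sub>F s in at_left 1. s * (1 + root_coef z J m * s ^ m) \<le> 1"
      using eventually_at_left_real[of 0 "1::real"]
    proof (rule eventually_mono)
      show "(0::real) < 1" by simp
      fix s :: real assume "s \<in> {0<..<1}"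
      then show "s * (1 + root_coef z J m * s ^ m) \<le> 1"
        using root_series_term_le[of s m J] that False by fastforce
    qed
    ultimately have "1 * (1 + root_coef z J m * 1 ^ m) \<le> 1"
      by (intro tendsto_upperbound) auto
    then show ?thesis using root_coef_bounds(1)[of J m] by simp
  qed
  have Jinf: "J = \<infinity>"
  proof (cases J)
    case (enat k)
    then show ?thesis using coef0[of "Suc k"] by (simp add: root_coef_def)
  qed
  have z0: "z j = 0" if "1 \<le> j" for j using coef0[of j] that Jinf by (simp add: root_coef_def)
  have phi: "phi z J w = 1 - w / 2" for w
    unfolding phi_def Jinf by (subst infsum_0) (auto simp: z0)
  have "w_c z J = 2"
    unfolding w_c_def phi by (rule Least_equality) auto
  moreover have "root_series z J t < 1" if "0 < t" "t < 1" for t using that False by force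
  ultimately show ?thesis by simp
qed

lemmas w_c_ge_1 = w_c_characterization[THEN conjunct1]
  and w_c_le_2 = w_c_characterization[THEN conjunct2, THEN conjunct1]

lemma root_series_less_1:
  assumes "0 < t" "t < w_c z J / 2"
  shows "root_series z J t < 1"
  using w_c_characterization[of J] assms by blast

text \<open>
  Replacing \<open>z j\<close> by 1 only increases the series.  Hence \<open>J = \<infinity>\<close> gives the strongest of all
  bounds, and a threshold for \<open>N\<close> that works for it works for every \<open>J\<close>.
\<close>
lemma w_c_le_w_c_infinity: "w_c z J \<le> w_c z \<infinity>"
proof (rule ccontr)
  assume "\<not> ?thesis"
  then obtain t where t: "w_c z \<infinity> / 2 < t" "t < w_c z J / 2"
    using dense[of "w_c z \<infinity> / 2" "w_c z J / 2"] by auto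
  have t01: "0 < t" "t < 1" using t w_c_ge_1[of \<infinity>] w_c_le_2[of J] by linarith+
  have "(\<Sum>j. root_coef z \<infinity> j * t ^ j) \<le> (\<Sum>j. root_coef z J j * t ^ j)"
    using t01 z
    by (intro suminf_le summable_root_coef mult_right_mono) (auto simp: root_coef_def)
  then have "root_series z \<infinity> t \<le> root_series z J t"
    unfolding root_series_def using t01 by (intro mult_left_mono) auto
  moreover have "root_series z J t < 1" by (rule root_series_less_1[OF t01(1) t(2)])
  moreover have "1 < root_series z \<infinity> t" using w_c_characterization[of \<infinity>] t t01 by blast
  ultimately show False by linarith
qed

end

lemma zcoef_bounds:
  assumes S: "\<And>N. 1 \<le> N \<Longrightarrow> S N \<in> carrier_mat N N"
  shows "limsup (\<lambda>N. ereal (row_norm (S N ^\<^sub>m j) / row_norm (S N) ^ j)) = ereal (zcoef S j)"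
    and "0 \<le> zcoef S j" and "zcoef S j \<le> 1"
proof -
  let ?q = "\<lambda>N. ereal (row_norm (S N ^\<^sub>m j) / row_norm (S N) ^ j)"
  have q: "0 \<le> ?q N" "?q N \<le> 1" if "1 \<le> N" for N
    using row_norm_pow_quotient[OF S[OF that], of j] that by simp_all
  have le: "limsup ?q \<le> 1"
    by (intro Limsup_bounded eventually_sequentiallyI[of 1] q)
  have "0 \<le> liminf ?q"
    by (intro Liminf_bounded eventually_sequentiallyI[of 1] q)
  then have ge: "0 \<le> limsup ?q" using Liminf_le_Limsup[OF sequentially_bot, of ?q] by (rule order_trans)
  show eq: "limsup ?q = ereal (zcoef S j)"
    unfolding zcoef_def using le ge by (intro ereal_real'[symmetric]) auto
  show "0 \<le> zcoef S j" "zcoef S j \<le> 1"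
    using le ge unfolding eq by simp_all
qed

text \<open>
  Any \<open>s\<close> slightly below \<open>w_c / 2\<close>, for \<open>J = \<infinity>\<close>, makes the series in \<open>\<phi>\<close> smaller than 1 with a gap.  A tail
  of the series fits into one half of the gap, and finitely many quotients are within the other half of
  their upper limits once \<open>N\<close> is large.  How close \<open>s\<close> has to be depends on \<open>\<epsilon>\<close> and on a common bound
  for the norms only.
\<close>
lemma eventually_supersolution:
  fixes S :: "nat \<Rightarrow> real mat"
  assumes S: "\<And>N. 1 \<le> N \<Longrightarrow> S N \<in> carrier_mat N N"
    and nonneg: "\<And>N x y. 1 \<le> N \<Longrightarrow> x < N \<Longrightarrow> y < N \<Longrightarrow> 0 \<le> S N $$ (x, y)"
    and B: "\<And>N. 1 \<le> N \<Longrightarrow> row_norm (S N) \<le> B" and \<epsilon>: "0 < \<epsilon>"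
  shows "\<exists>N\<^sub>0. \<forall>N\<ge>N\<^sub>0. 1 \<le> N \<longrightarrow> (\<exists>s r. 1 / 4 \<le> s \<and>
    (\<forall>x<N. 1 \<le> r x \<and> r x \<le> 1 / s \<and> s\<^sup>2 * (\<Sum>y<N. S N $$ (x, y) * r y) \<le> row_norm (S N) * (1 - 1 / r x)) \<and>
    (\<forall>J. sqrt (row_norm (S N)) / s \<le> 2 * sqrt (row_norm (S N)) / w_c (zcoef S) J + \<epsilon>))"
proof -
  let ?z = "zcoef S"
  have z: "0 \<le> ?z j" "?z j \<le> 1" for j using zcoef_bounds(2,3)[of S j] S by blast+
  have lim: "limsup (\<lambda>N. ereal (row_norm (S N ^\<^sub>m j) / row_norm (S N) ^ j)) = ereal (?z j)" for j
    using zcoef_bounds(1)[of S j] S by blast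
  define w where "w = w_c ?z \<infinity>"
  have w: "1 \<le> w" "w \<le> 2" unfolding w_def using w_c_ge_1[of ?z] w_c_le_2[of ?z] z by auto
  have B0: "0 \<le> B" using row_norm_nonneg[OF S[of 1]] B[of 1] by simp
  define t where "t = min 1 (\<epsilon> / (sqrt B + 1))"
  have t: "0 < t" "t \<le> 1" "sqrt B * t \<le> \<epsilon>"
  proof -
    have p: "0 < sqrt B + 1" using B0 by (simp add: add_nonneg_pos)
    then show "0 < t" "t \<le> 1" using \<epsilon> by (simp_all add: t_def)
    have "sqrt B * t \<le> (sqrt B + 1) * (\<epsilon> / (sqrt B + 1))"
      using B0 \<epsilon> p by (intro mult_mono) (auto simp: t_def)
    then show "sqrt B * t \<le> \<epsilon>" using p by simp
  qed
  define s where "s = 1 / (2 / w + t)"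
  have w2: "0 < 2 / w" "1 \<le> 2 / w" "2 / w \<le> 2" using w by (simp_all add: field_simps)
  have s: "1 / 4 \<le> s" "s < w / 2" "1 / s = 2 / w + t"
  proof -
    show "1 / s = 2 / w + t" by (simp add: s_def)
    have "1 / 4 \<le> 1 / (2 / w + t)" using w2 t by (intro divide_left_mono mult_pos_pos) linarith+
    then show "1 / 4 \<le> s" by (simp add: s_def)
    have "1 / (2 / w + t) < 1 / (2 / w)" using w2 t by (intro divide_strict_left_mono mult_pos_pos add_pos_pos) linarith+
    then show "s < w / 2" by (simp add: s_def)
  qed
  have s01: "0 < s" "s < 1" using s w by auto
  define gap where "gap = 1 - root_series ?z \<infinity> s"
  have gap: "0 < gap" using root_series_less_1[of ?z s \<infinity>] z s01 s(2) by (simp add: gap_def w_def)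
  have "(\<lambda>m. s * (s ^ m / (1 - s))) \<longlonglongrightarrow> s * (0 / (1 - s))"
    using s01 by (intro tendsto_intros LIMSEQ_power_zero) auto
  then have "\<forall>\<^sub>F m in sequentially. s * (s ^ m / (1 - s)) < gap / 2"
    by (rule order_tendstoD(2)) (use gap in simp)
  then obtain m where m: "s * (s ^ m / (1 - s)) < gap / 2"
    by (auto simp: eventually_sequentially)
  let ?q = "\<lambda>N j. row_norm (S N ^\<^sub>m j) / row_norm (S N) ^ j"
  define \<delta> where "\<delta> = gap * (1 - s) / 2"
  have \<delta>: "0 < \<delta>" using gap s01 by (simp add: \<delta>_def)
  have "\<forall>\<^sub>F N in sequentially. \<forall>j\<in>{..<m}. ?q N j < ?z j + \<delta>"
  proof (intro eventually_ball_finite ballI finite_lessThan)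
    fix j
    have "limsup (\<lambda>N. ereal (?q N j)) < ereal (?z j + \<delta>)"
      unfolding lim using \<delta> by simp
    then have "\<forall>\<^sub>F N in sequentially. ereal (?q N j) < ereal (?z j + \<delta>)" by (rule Limsup_lessD)
    then show "\<forall>\<^sub>F N in sequentially. ?q N j < ?z j + \<delta>" by simp
  qed
  then obtain N\<^sub>0 where N\<^sub>0: "\<And>N j. N\<^sub>0 \<le> N \<Longrightarrow> j < m \<Longrightarrow> ?q N j < ?z j + \<delta>"
    by (auto simp: eventually_sequentially)
  have main: "\<exists>s r. 1 / 4 \<le> s \<and>
    (\<forall>x<N. 1 \<le> r x \<and> r x \<le> 1 / s \<and> s\<^sup>2 * (\<Sum>y<N. S N $$ (x, y) * r y) \<le> row_norm (S N) * (1 - 1 / r x)) \<and>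
    (\<forall>J. sqrt (row_norm (S N)) / s \<le> 2 * sqrt (row_norm (S N)) / w_c ?z J + \<epsilon>)"
    if N: "N\<^sub>0 \<le> N" "1 \<le> N" for N
  proof -
    have N': "0 < N" using N by simp
    have q: "?q N j \<le> root_coef ?z \<infinity> j + \<delta>" if "j < m" for j
    proof (cases "j = 0")
      case True
      then show ?thesis using row_norm_pow_quotient(2)[OF S[OF N(2)] N', of 0] \<delta> by (simp add: root_coef_def)
    next
      case False
      then show ?thesis using N\<^sub>0[OF N(1) that] by (simp add: root_coef_def)
    qed
    have "(\<Sum>j<m. s ^ j * ?q N j) \<le> (\<Sum>j<m. s ^ j * (root_coef ?z \<infinity> j + \<delta>))"
      using q s01 by (intro sum_mono mult_left_mono) auto
    also have "\<dots> = (\<Sum>j<m. root_coef ?z \<infinity> j * s ^ j) + \<delta> * (\<Sum>j<m. s ^ j)"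
      by (simp add: distrib_left sum.distrib sum_distrib_left mult_ac)
    also have "(\<Sum>j<m. root_coef ?z \<infinity> j * s ^ j) \<le> (\<Sum>j. root_coef ?z \<infinity> j * s ^ j)"
      using s01 z by (intro sum_le_suminf summable_root_coef) (auto simp: root_coef_bounds)
    also have "(\<Sum>j<m. s ^ j) \<le> 1 / (1 - s)"
      using sum_le_suminf[of "\<lambda>j. s ^ j" "{..<m}"] s01 suminf_geometric[of s] by (simp add: summable_geometric)
    finally have "(\<Sum>j<m. s ^ j * ?q N j) \<le> (\<Sum>j. root_coef ?z \<infinity> j * s ^ j) + \<delta> * (1 / (1 - s))"
      using \<delta> by (simp add: mult_left_mono)
    then have "s * (\<Sum>j<m. s ^ j * ?q N j) \<le> s * ((\<Sum>j. root_coef ?z \<infinity> j * s ^ j) + \<delta> * (1 / (1 - s)))"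
      using s01 by (intro mult_left_mono) auto
    also have "\<delta> * (1 / (1 - s)) = gap / 2" using s01 by (simp add: \<delta>_def field_simps)
    also have "s * ((\<Sum>j. root_coef ?z \<infinity> j * s ^ j) + gap / 2) = root_series ?z \<infinity> s + s * (gap / 2)"
      by (simp only: root_series_def distrib_left)
    also have "\<dots> \<le> root_series ?z \<infinity> s + gap / 2" using s01 gap by (simp add: mult_left_le_one_le)
    finally have "s * (\<Sum>j<m. s ^ j * ?q N j) \<le> 1 - gap / 2" by (simp add: gap_def field_simps)
    then have "s * ((\<Sum>j<m. s ^ j * ?q N j) + s ^ m / (1 - s)) \<le> 1"
      using m unfolding distrib_left by linarith
    from dyson_supersolution[OF S[OF N(2)] N' nonneg[OF N(2)] s01 this]
    obtain r where r: "\<And>x. x < N \<Longrightarrow> 1 \<le> r x" "\<And>x. x < N \<Longrightarrow> r x \<le> 1 / s"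
      "\<And>x. x < N \<Longrightarrow> s\<^sup>2 * (\<Sum>y<N. S N $$ (x, y) * r y) \<le> row_norm (S N) * (1 - 1 / r x)"
      by blast
    let ?\<sigma> = "sqrt (row_norm (S N))"
    have \<sigma>: "0 \<le> ?\<sigma>" "?\<sigma> \<le> sqrt B" using row_norm_nonneg[OF S[OF N(2)] N'] B[OF N(2)] by simp_all
    have "?\<sigma> / s \<le> 2 * ?\<sigma> / w_c ?z J + \<epsilon>" for J
    proof -
      have wJ: "1 \<le> w_c ?z J" "w_c ?z J \<le> w"
        unfolding w_def using w_c_ge_1[of ?z] w_c_le_w_c_infinity[of ?z] z by auto
      have "?\<sigma> / s = ?\<sigma> * (2 / w + t)" by (simp only: s(3)[symmetric]) simp
      also have "\<dots> = 2 * ?\<sigma> / w + ?\<sigma> * t" by (simp add: distrib_left)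
      also have "?\<sigma> * t \<le> sqrt B * t" using \<sigma> t by (intro mult_right_mono) auto
      also have "2 * ?\<sigma> / w \<le> 2 * ?\<sigma> / w_c ?z J" using wJ \<sigma> by (intro divide_left_mono) auto
      finally show ?thesis using t(3) by linarith
    qed
    then show ?thesis using s(1) r by blast
  qed
  then show ?thesis by blast
qed

section \<open>A supermartingale on walks\<close>

definition edge :: "nat \<Rightarrow> nat \<Rightarrow> nat \<times> nat" where
  "edge x y = (min x y, max x y)"

text \<open>
  A walk is the list of its vertices in reverse order: the head is the current vertex, and a step
  is a \<^const>\<open>Cons\<close>.
\<close>
fun walk_edges :: "nat list \<Rightarrow> (nat \<times> nat) list" where
  "walk_edges (y # v # p) = edge y v # walk_edges (v # p)"
| "walk_edges _ = []"

text \<open>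
  An edge is open while it has been used exactly once.  If the expectation of a product of matrix
  entries is to be of leading order, every edge must eventually be closed, and for a depth first
  exploration of a tree the open edges are those on the path from the root to the current vertex.
\<close>
definition open_edges :: "nat list \<Rightarrow> (nat \<times> nat) set" where
  "open_edges p = {e. count_list (walk_edges p) e = 1}"

text \<open>
  A loop counts twice, so that every use of an edge changes the degrees of both of its ends, as for
  the other edges.
\<close>
definition endpoint_count :: "nat \<times> nat \<Rightarrow> nat \<Rightarrow> nat" where
  "endpoint_count e w = of_bool (fst e = w) + of_bool (snd e = w)"

definition open_degree :: "nat list \<Rightarrow> nat \<Rightarrow> nat" where
  "open_degree p w = (\<Sum>e\<in>open_edges p. endpoint_count e w)"

text \<open>
  The number of half-edges at \<open>w\<close> that are waiting to be matched, the walker counting as one.  In a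
  depth first exploration it is 2 on the active path (1 at the root) and 0 elsewhere.
\<close>
definition slots :: "nat list \<Rightarrow> nat \<Rightarrow> nat" where
  "slots p w = open_degree p w + of_bool (w = hd p)"

text \<open>
  The factor for the use number \<open>m + 1\<close> of the edge \<open>e\<close>.  The product over the uses of one edge is
  \<open>\<theta> S\<close> for one use and \<open>S K^(m - 2)\<close> for \<open>m \<ge> 2\<close> uses, which are the bounds for \<open>\<bar>E X\<bar>\<close> and
  \<open>E \<bar>X\<bar>^m\<close> of a nearly centered variable of variance at most \<open>S\<close> that is bounded by \<open>K\<close>.
\<close>
definition step_factor :: "real \<Rightarrow> real \<Rightarrow> (nat \<times> nat \<Rightarrow> real) \<Rightarrow> nat \<times> nat \<Rightarrow> nat \<Rightarrow> real" where
  "step_factor \<theta> K S e m = (if m = 0 then \<theta> * S e else if m = 1 then 1 / \<theta> else K)"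

fun walk_weight :: "real \<Rightarrow> real \<Rightarrow> (nat \<times> nat \<Rightarrow> real) \<Rightarrow> nat list \<Rightarrow> real" where
  "walk_weight \<theta> K S (y # v # p) =
     walk_weight \<theta> K S (v # p) * step_factor \<theta> K S (edge y v) (count_list (walk_edges (v # p)) (edge y v))"
| "walk_weight \<theta> K S _ = 1"

text \<open>
  With \<open>a\<close> the value of the supersolution at the vertex, 1 or 2 slots stand for an active vertex of a
  depth first exploration, which may still start excursions of total weight \<open>a\<close>.  More slots
  arise only when the walk is not a depth first exploration.  Each additional one is
  penalized by a large factor \<open>L\<close>, which pays for the choice among several open edges later on.
\<close>
definition site_potential :: "real \<Rightarrow> real \<Rightarrow> nat \<Rightarrow> real" where
  "site_potential L a q = (if q = 0 then 1 else a * L ^ (q - 2))"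

definition walks :: "nat \<Rightarrow> nat \<Rightarrow> nat list set" where
  "walks N n = {p. length p = Suc n \<and> set p \<subseteq> {..<N}}"

lemma edge_commute: "edge x y = edge y x"
  by (simp add: edge_def min.commute max.commute)

lemma edge_right_inject: "edge x v = edge y v \<longleftrightarrow> x = y"
  by (auto simp: edge_def min_def max_def split: if_splits)

lemma endpoint_count_edge:
  "endpoint_count (edge y v) w = of_bool (w = y) + of_bool (w = v)"
  by (auto simp: endpoint_count_def edge_def min_def max_def)

lemma walk_edges_ends: "e \<in> set (walk_edges p) \<Longrightarrow> fst e \<in> set p \<and> snd e \<in> set p"
  by (induction p rule: walk_edges.induct) (auto simp: edge_def min_def max_def split: if_splits)

lemma walk_edges_endpoint: "edge y v \<in> set (walk_edges p) \<Longrightarrow> y \<in> set p"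
  using walk_edges_ends[of "edge y v" p] by (auto simp: edge_def min_def max_def split: if_splits)

lemma walk_edges_subset:
  "set p \<subseteq> {..<N} \<Longrightarrow> set (walk_edges p) \<subseteq> {(x, y). x \<le> y \<and> y < N}"
  by (induction p rule: walk_edges.induct) (auto simp: edge_def)

lemma finite_open_edges: "finite (open_edges p)"
proof (rule finite_subset)
  show "open_edges p \<subseteq> set (walk_edges p)"
  proof
    fix e assume "e \<in> open_edges p"
    then have "count_list (walk_edges p) e \<noteq> 0" unfolding open_edges_def mem_Collect_eq by linarith
    then show "e \<in> set (walk_edges p)" unfolding count_list_0_iff by simp
  qed
qed simp

lemma open_edges_Cons:
  "open_edges (y # v # p) =
     (if count_list (walk_edges (v # p)) (edge y v) = 0 then insert (edge y v) (open_edges (v # p))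
      else if count_list (walk_edges (v # p)) (edge y v) = 1 then open_edges (v # p) - {edge y v}
      else open_edges (v # p))"
proof (rule Set.set_eqI)
  fix e show "e \<in> open_edges (y # v # p) \<longleftrightarrow> e \<in> (if count_list (walk_edges (v # p)) (edge y v) = 0 then insert (edge y v) (open_edges (v # p))
      else if count_list (walk_edges (v # p)) (edge y v) = 1 then open_edges (v # p) - {edge y v}
      else open_edges (v # p))"
    by (cases "e = edge y v") (simp_all add: open_edges_def)
qed

text \<open>
  The next three lemmas are the whole bookkeeping of the walk: the first use of an edge adds two
  slots at the vertex that is entered, its second use removes two slots at the vertex that is left, and any later
  use moves one slot from the latter to the former.
\<close>
lemma slots_first_use:
  assumes "count_list (walk_edges (v # p)) (edge y v) = 0"
  shows "slots (y # v # p) w = slots (v # p) w + 2 * of_bool (w = y)"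
proof -
  have "edge y v \<notin> open_edges (v # p)" using assms by (simp add: open_edges_def)
  moreover have "open_edges (y # v # p) = insert (edge y v) (open_edges (v # p))"
    unfolding open_edges_Cons if_P[OF assms] by (rule refl)
  ultimately have "open_degree (y # v # p) w = endpoint_count (edge y v) w + open_degree (v # p) w"
    unfolding open_degree_def by (simp only: sum.insert finite_open_edges not_False_eq_True)
  then show ?thesis by (simp add: slots_def endpoint_count_edge)
qed

lemma slots_second_use:
  assumes "count_list (walk_edges (v # p)) (edge y v) = 1"
  shows "slots (y # v # p) w + 2 * of_bool (w = v) = slots (v # p) w"
proof -
  have "edge y v \<in> open_edges (v # p)" using assms by (simp add: open_edges_def)
  moreover have "open_edges (y # v # p) = open_edges (v # p) - {edge y v}"
    unfolding open_edges_Cons assms by simp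
  ultimately have "open_degree (v # p) w = endpoint_count (edge y v) w + open_degree (y # v # p) w"
    unfolding open_degree_def by (simp only: sum.remove finite_open_edges)
  then show ?thesis by (simp add: slots_def endpoint_count_edge)
qed

lemma slots_further_use:
  assumes "1 < count_list (walk_edges (v # p)) (edge y v)"
  shows "slots (y # v # p) w + of_bool (w = v) = slots (v # p) w + of_bool (w = y)"
proof -
  have "open_edges (y # v # p) = open_edges (v # p)"
    unfolding open_edges_Cons using assms by simp
  then have "open_degree (y # v # p) w = open_degree (v # p) w" by (simp only: open_degree_def)
  then show ?thesis by (simp add: slots_def)
qed

lemma card_open_neighbours:
  "card {y. edge y v \<in> open_edges p} \<le> open_degree p v"
proof -
  have inj: "inj_on (\<lambda>y. edge y v) {y. edge y v \<in> open_edges p}"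
    by (auto simp: inj_on_def edge_right_inject)
  have "card {y. edge y v \<in> open_edges p} = (\<Sum>y | edge y v \<in> open_edges p. 1)" by simp
  also have "\<dots> \<le> (\<Sum>y | edge y v \<in> open_edges p. endpoint_count (edge y v) v)"
    by (intro sum_mono) (simp add: endpoint_count_edge)
  also have "\<dots> = (\<Sum>e\<in>(\<lambda>y. edge y v) ` {y. edge y v \<in> open_edges p}. endpoint_count e v)"
    by (simp add: sum.reindex[OF inj])
  also have "\<dots> \<le> open_degree p v"
    unfolding open_degree_def by (intro sum_mono2 finite_open_edges) auto
  finally show ?thesis .
qed

lemma site_potential_ge_1: "1 \<le> L \<Longrightarrow> 1 \<le> a \<Longrightarrow> 1 \<le> site_potential L a q"
  using mult_mono[of 1 a 1 "L ^ (q - 2)"] by (auto simp: site_potential_def)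

lemma site_potential_mono:
  assumes "1 \<le> L" "1 \<le> a" "q \<le> q'"
  shows "site_potential L a q \<le> site_potential L a q'"
proof (cases "q = 0")
  case True
  then show ?thesis using site_potential_ge_1[OF assms(1,2), of q'] by (simp add: site_potential_def)
next
  case False
  then show ?thesis using assms by (simp add: site_potential_def power_increasing mult_left_mono diff_le_mono)
qed

lemma site_potential_add_2:
  assumes "1 \<le> L" "1 \<le> a"
  shows "site_potential L a (q + 2) \<le> site_potential L a q * (if q = 0 then a else L\<^sup>2)"
proof (cases "q \<ge> 2")
  case True
  then obtain r where "q = r + 2" using le_Suc_ex add.commute by metis
  then show ?thesis by (simp add: site_potential_def power_add power2_eq_square mult_ac)
next
  case False
  then have "q = 0 \<or> q = 1" by auto
  then show ?thesis using assms by (auto simp: site_potential_def power2_eq_square)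
qed

lemma site_potential_Suc:
  assumes "1 \<le> L" "1 \<le> a" "a \<le> U"
  shows "site_potential L a (q + 1) \<le> site_potential L a q * (L * U)"
proof (cases "q \<ge> 2")
  case True
  then obtain r where r: "q = r + 2" using le_Suc_ex add.commute by metis
  have "L * 1 \<le> L * U" using assms by (intro mult_left_mono) auto
  then have "(a * L ^ r) * L \<le> (a * L ^ r) * (L * U)" using assms by (intro mult_left_mono) auto
  then show ?thesis by (simp add: r site_potential_def mult_ac)
next
  case False
  then have "q = 0 \<or> q = 1" by auto
  moreover have "1 * a \<le> L * U" using assms by (intro mult_mono) auto
  moreover have "a * (1 * 1) \<le> a * (L * U)" using assms by (intro mult_left_mono mult_mono) auto
  ultimately show ?thesis by (auto simp: site_potential_def)
qed

text \<open>
  Closing one of \<open>d\<close> open edges: if there is no choice, the vertex is finished at the price of its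
  excursion weight; otherwise a factor \<open>L\<close> is released for at most \<open>d\<close> choices.
\<close>
lemma site_potential_minus_2:
  assumes "1 \<le> L" "1 \<le> a" "1 \<le> d" "q + 2 = d + 1"
  shows "site_potential L a q \<le> site_potential L a (d + 1) * (if d = 1 then 1 / a else 1 / L)"
proof -
  have "d = 1 \<or> d = 2 \<or> (\<exists>r. d = r + 3)" using assms(3) by presburger
  then consider "d = 1" | "d = 2" | r where "d = r + 3" by blast
  then show ?thesis
  proof cases
    case 1
    then show ?thesis using assms by (simp add: site_potential_def)
  next
    case 2
    then show ?thesis using assms by (simp add: site_potential_def)
  next
    case 3
    then have q: "q = r + 2" using assms(4) by simp
    have "a * L ^ r \<le> a * L ^ Suc r" using assms by (intro mult_left_mono power_increasing) auto
    then show ?thesis using assms 3 by (simp add: q site_potential_def power_Suc)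
  qed
qed

lemma prod_le_scale_one:
  fixes f g :: "'b \<Rightarrow> real"
  assumes "finite A" "y \<in> A" "\<And>w. w \<in> A \<Longrightarrow> w \<noteq> y \<Longrightarrow> f w = g w" "\<And>w. w \<in> A \<Longrightarrow> 0 \<le> g w" "f y \<le> g y * r"
  shows "prod f A \<le> prod g A * r"
proof -
  have "prod f A = f y * prod g (A - {y})"
    using assms by (subst prod.remove[of _ y]) auto
  also have "\<dots> \<le> g y * r * prod g (A - {y})"
    using assms by (intro mult_right_mono prod_nonneg) auto
  also have "\<dots> = prod g A * r"
    using assms by (subst (2) prod.remove[of _ y]) auto
  finally show ?thesis .
qed

lemma sum_of_bool_mem:
  "finite A \<Longrightarrow> B \<subseteq> A \<Longrightarrow> (\<Sum>y\<in>A. of_bool (y \<in> B)) = real (card B)"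
  by (simp add: of_bool_def sum.If_cases Int_absorb1)

lemma sum_walks_0: "(\<Sum>p\<in>walks N 0. f p) = (\<Sum>x<N. f [x])"
proof -
  have "walks N 0 = (\<lambda>x. [x]) ` {..<N}" by (auto simp: walks_def length_Suc_conv)
  then show ?thesis by (simp add: sum.reindex inj_on_def)
qed

lemma sum_walks_Suc: "(\<Sum>p\<in>walks N (Suc n). f p) = (\<Sum>p\<in>walks N n. \<Sum>y<N. f (y # p))"
proof -
  have "walks N (Suc n) = (\<lambda>(p, y). y # p) ` (walks N n \<times> {..<N})"
    by (force simp: walks_def length_Suc_conv image_def)
  moreover have "inj_on (\<lambda>(p, y). y # p) (walks N n \<times> {..<N})" by (auto simp: inj_on_def)
  ultimately show ?thesis
    by (simp add: sum.reindex case_prod_unfold sum.cartesian_product)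
qed

lemma walk_weight_eq_prod:
  assumes "finite E" "set (walk_edges p) \<subseteq> E"
  shows "walk_weight \<theta> K S p = (\<Prod>e\<in>E. \<Prod>j<count_list (walk_edges p) e. step_factor \<theta> K S e j)"
  using assms(2)
proof (induction p rule: walk_edges.induct)
  case (1 y v p)
  let ?e = "edge y v" and ?c = "count_list (walk_edges (v # p))"
  have e: "?e \<in> E" using 1(2) by simp
  have "(\<Prod>e\<in>E. \<Prod>j<count_list (walk_edges (y # v # p)) e. step_factor \<theta> K S e j)
      = (\<Prod>e\<in>E. (\<Prod>j<?c e. step_factor \<theta> K S e j) * (if e = ?e then step_factor \<theta> K S ?e (?c ?e) else 1))"
    by (intro prod.cong) auto
  also have "\<dots> = (\<Prod>e\<in>E. \<Prod>j<?c e. step_factor \<theta> K S e j) * step_factor \<theta> K S ?e (?c ?e)"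
    using e assms(1) by (simp add: prod.distrib prod.delta)
  finally show ?case using 1 by simp
qed simp_all

lemma walk_weight_nonneg:
  assumes "0 \<le> \<theta>" "0 \<le> K" "\<And>e. 0 \<le> S e"
  shows "0 \<le> walk_weight \<theta> K S p"
  using assms by (induction \<theta> K S p rule: walk_weight.induct) (auto simp: step_factor_def)


text \<open>
  The assumption \<open>dyson\<close> says that \<open>u\<close> is a strict supersolution of the Dyson equation, with a margin
  that absorbs the two kinds of steps that a depth first exploration does not make: first uses
  of an edge to a vertex already visited, which cost \<open>S \<le> c\<close>, and further uses of an edge, which cost
  \<open>K\<close>.  In either case there are at most \<open>n\<close> possible targets.
\<close>
context
  fixes N n :: nat and \<theta> K L U c :: real and S :: "nat \<times> nat \<Rightarrow> real" and u :: "nat \<Rightarrow> real"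
  assumes \<theta>: "0 < \<theta>" and K: "0 \<le> K" and U: "1 \<le> U" and L: "1 \<le> L" "real n * U \<le> L" and c: "0 \<le> c"
    and S: "\<And>e. 0 \<le> S e" "\<And>e. S e \<le> c"
    and u: "\<And>x. x < N \<Longrightarrow> 1 \<le> u x" "\<And>x. x < N \<Longrightarrow> u x \<le> U"
    and dyson: "\<And>v. v < N \<Longrightarrow>
      1 / u v + \<theta>\<^sup>2 * (\<Sum>y<N. S (edge y v) * u y) + (\<theta>\<^sup>2 * real n * c * L\<^sup>2 + \<theta> * real n * K * L * U) \<le> 1"
begin

definition potential :: "nat list \<Rightarrow> real" where
  "potential p = (\<Prod>w<N. site_potential L (u w) (slots p w))"

lemma potential_ge_1: "1 \<le> potential p"
  unfolding potential_def using L u by (intro prod_ge_1 site_potential_ge_1) auto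

text \<open>
  A vertex that is not on the walk has no slots and becomes active, with weight \<open>u y\<close>; a visited one
  may gain two penalized slots.
\<close>
lemma potential_first_use:
  assumes "count_list (walk_edges (v # p)) (edge y v) = 0" "y < N"
  shows "potential (y # v # p) \<le> potential (v # p) * (u y + of_bool (y \<in> set (v # p)) * L\<^sup>2)"
proof -
  have slot0: "y \<in> set (v # p)" if nz: "slots (v # p) y \<noteq> 0"
  proof (rule ccontr)
    assume y: "y \<notin> set (v # p)"
    have "endpoint_count e y = 0" if e: "e \<in> open_edges (v # p)" for e
    proof (rule ccontr)
      assume "endpoint_count e y \<noteq> 0"
      then have "fst e = y \<or> snd e = y" by (auto simp: endpoint_count_def)
      moreover have "e \<in> set (walk_edges (v # p))"
        using e unfolding open_edges_def by (metis (mono_tags) count_notin mem_Collect_eq zero_neq_one)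
      ultimately show False using walk_edges_ends[of e "v # p"] y by auto
    qed
    then have "open_degree (v # p) y = 0" unfolding open_degree_def by simp
    then show False using nz y by (simp add: slots_def)
  qed
  have "potential (y # v # p) \<le> potential (v # p) * (if slots (v # p) y = 0 then u y else L\<^sup>2)"
    unfolding potential_def
  proof (rule prod_le_scale_one[of _ y])
    show "site_potential L (u y) (slots (y # v # p) y)
        \<le> site_potential L (u y) (slots (v # p) y) * (if slots (v # p) y = 0 then u y else L\<^sup>2)"
      using site_potential_add_2[OF L(1) u(1)[OF assms(2)], of "slots (v # p) y"]
      by (simp add: slots_first_use[OF assms(1)])
    show "0 \<le> site_potential L (u w) (slots (v # p) w)" if "w \<in> {..<N}" for w
      using site_potential_ge_1[OF L(1) u(1), of w "slots (v # p) w"] that by auto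
  qed (use assms(2) in \<open>auto simp: slots_first_use[OF assms(1)]\<close>)
  also have "\<dots> \<le> potential (v # p) * (u y + of_bool (y \<in> set (v # p)) * L\<^sup>2)"
  proof (rule mult_left_mono)
    show "(if slots (v # p) y = 0 then u y else L\<^sup>2) \<le> u y + of_bool (y \<in> set (v # p)) * L\<^sup>2"
    proof (cases "slots (v # p) y = 0")
      case False
      then show ?thesis using slot0 u(1)[OF assms(2)] by simp
    qed simp
    show "0 \<le> potential (v # p)" using potential_ge_1[of "v # p"] by simp
  qed
  finally show ?thesis .
qed

lemma potential_second_use:
  assumes "count_list (walk_edges (v # p)) (edge y v) = 1" "v < N"
  shows "potential (y # v # p)
    \<le> potential (v # p) * (if open_degree (v # p) v = 1 then 1 / u v else 1 / L)"
  unfolding potential_def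
proof (rule prod_le_scale_one[of _ v])
  have upd: "slots (y # v # p) w + 2 * of_bool (w = v) = slots (v # p) w" for w
    by (rule slots_second_use[OF assms(1)])
  have sv: "slots (v # p) v = open_degree (v # p) v + 1" by (simp add: slots_def)
  show "site_potential L (u v) (slots (y # v # p) v) \<le> site_potential L (u v) (slots (v # p) v) *
      (if open_degree (v # p) v = 1 then 1 / u v else 1 / L)"
    unfolding sv
    using upd[of v] sv by (intro site_potential_minus_2 L(1) u(1) assms(2)) auto
  show "0 \<le> site_potential L (u w) (slots (v # p) w)" if "w \<in> {..<N}" for w
    using site_potential_ge_1[OF L(1) u(1), of w "slots (v # p) w"] that by auto
  show "site_potential L (u w) (slots (y # v # p) w) = site_potential L (u w) (slots (v # p) w)"
    if "w \<in> {..<N}" "w \<noteq> v" for w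
    using upd[of w] that by simp
qed (use assms(2) in auto)

lemma potential_further_use:
  assumes "1 < count_list (walk_edges (v # p)) (edge y v)" "y < N"
  shows "potential (y # v # p) \<le> potential (v # p) * (L * U)"
proof -
  have "potential (y # v # p) \<le> (\<Prod>w<N. site_potential L (u w) (slots (v # p) w + of_bool (w = y)))"
    unfolding potential_def
  proof (intro prod_mono conjI)
    fix w assume w: "w \<in> {..<N}"
    show "0 \<le> site_potential L (u w) (slots (y # v # p) w)"
      using site_potential_ge_1[OF L(1) u(1), of w "slots (y # v # p) w"] w by auto
    have "slots (y # v # p) w \<le> slots (v # p) w + of_bool (w = y)"
      using slots_further_use[OF assms(1), of w] by linarith
    then show "site_potential L (u w) (slots (y # v # p) w)
        \<le> site_potential L (u w) (slots (v # p) w + of_bool (w = y))"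
      using w by (intro site_potential_mono L(1) u(1)) auto
  qed
  also have "\<dots> \<le> potential (v # p) * (L * U)"
    unfolding potential_def
  proof (rule prod_le_scale_one[of _ y])
    show "site_potential L (u y) (slots (v # p) y + of_bool (y = y)) \<le> site_potential L (u y) (slots (v # p) y) * (L * U)"
      using site_potential_Suc[OF L(1) u(1)[OF assms(2)] u(2)[OF assms(2)], of "slots (v # p) y"] by simp
    show "0 \<le> site_potential L (u w) (slots (v # p) w)" if "w \<in> {..<N}" for w
      using site_potential_ge_1[OF L(1) u(1), of w "slots (v # p) w"] that by auto
  qed (use assms(2) in auto)
  finally show ?thesis .
qed

lemma potential_step:
  assumes v: "v < N" and y: "y < N"
  shows "step_factor \<theta> K S (edge y v) (count_list (walk_edges (v # p)) (edge y v)) * potential (y # v # p)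
    \<le> potential (v # p) *
      (\<theta> * (S (edge y v) * u y) + of_bool (y \<in> set (v # p)) * (\<theta> * c * L\<^sup>2 + K * L * U)
       + of_bool (edge y v \<in> open_edges (v # p)) * (1 / \<theta> * (if open_degree (v # p) v = 1 then 1 / u v else 1 / L)))"
    (is "?f * ?P' \<le> ?P * (?A + ?B + ?C)")
proof -
  have P: "0 \<le> ?P" using potential_ge_1[of "v # p"] by simp
  have A: "0 \<le> ?A" using \<theta> S(1) u(1)[OF y] by simp
  have B: "0 \<le> ?B" using \<theta> c K L U by simp
  have C: "0 \<le> ?C" using \<theta> L u(1)[OF v] by simp
  let ?m = "count_list (walk_edges (v # p)) (edge y v)"
  consider "?m = 0" | "?m = 1" | "1 < ?m" by linarith
  then show ?thesis
  proof cases
    case 1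
    have "?f * ?P' \<le> \<theta> * S (edge y v) * (?P * (u y + of_bool (y \<in> set (v # p)) * L\<^sup>2))"
      unfolding step_factor_def using 1 \<theta> S(1) potential_first_use[OF 1 y] by (simp add: mult_left_mono)
    also have "\<dots> = ?P * (?A + of_bool (y \<in> set (v # p)) * (\<theta> * S (edge y v) * L\<^sup>2))"
      by (simp add: algebra_simps)
    also have "\<dots> \<le> ?P * (?A + ?B)"
    proof (intro mult_left_mono add_left_mono P)
      have "\<theta> * S (edge y v) * L\<^sup>2 \<le> \<theta> * c * L\<^sup>2"
        using S(2) \<theta> by (intro mult_right_mono mult_left_mono) auto
      moreover have "0 \<le> K * L * U" using K L U by simp
      ultimately show "\<theta> * S (edge y v) * L\<^sup>2 \<le> \<theta> * c * L\<^sup>2 + K * L * U" by linarith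
    qed simp
    also have "\<dots> \<le> ?P * (?A + ?B + ?C)" using P C by (intro mult_left_mono) auto
    finally show ?thesis .
  next
    case 2
    have "?f * ?P' \<le> 1 / \<theta> * (?P * (if open_degree (v # p) v = 1 then 1 / u v else 1 / L))"
      unfolding step_factor_def using 2 \<theta> potential_second_use[OF 2 v]
      by (simp only: if_True if_False zero_neq_one one_neq_zero refl) (intro mult_left_mono, auto)
    also have "\<dots> = ?P * ?C" using 2 by (simp add: open_edges_def)
    also have "\<dots> \<le> ?P * (?A + ?B + ?C)" using P A B by (intro mult_left_mono) auto
    finally show ?thesis .
  next
    case 3
    then have "edge y v \<in> set (walk_edges (v # p))" by (metis count_notin not_less_zero)
    then have yp: "y \<in> set (v # p)" by (rule walk_edges_endpoint)
    have "?f * ?P' \<le> K * (?P * (L * U))"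
      unfolding step_factor_def using 3 K potential_further_use[OF 3 y] by (simp add: mult_left_mono)
    also have "\<dots> = ?P * (K * L * U)" by (simp add: mult_ac)
    also have "\<dots> \<le> ?P * (?A + ?B + ?C)"
    proof (intro mult_left_mono P)
      have "0 \<le> \<theta> * c * L\<^sup>2" using \<theta> c by simp
      then have "K * L * U \<le> ?B" using yp by simp
      then show "K * L * U \<le> ?A + ?B + ?C" using A C by linarith
    qed
    finally show ?thesis .
  qed
qed

text \<open>
  The weight times the potential is a supermartingale up to the factor \<open>1 / \<theta>\<close>.  The sum over the
  next vertex splits into first uses of edges, which contribute \<open>\<theta> (S u)\<close> plus a small term, the second
  uses, which contribute at most \<open>1 / (\<theta> u)\<close>, and the later uses, which contribute a small term.
  Their total is at most \<open>1 / \<theta>\<close> by the supersolution property.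
\<close>
lemma sum_potential_step:
  assumes p: "set (v # p) \<subseteq> {..<N}" "length (v # p) \<le> n"
  shows "(\<Sum>y<N. walk_weight \<theta> K S (y # v # p) * potential (y # v # p))
    \<le> 1 / \<theta> * (walk_weight \<theta> K S (v # p) * potential (v # p))"
proof -
  have v: "v < N" using p by simp
  let ?d = "open_degree (v # p) v" and ?V = "set (v # p)"
  let ?r = "if ?d = 1 then 1 / u v else 1 / L"
  have card_V: "real (card ?V) \<le> real n" using card_length[of "v # p"] p(2) by linarith
  define Y where "Y = {y. edge y v \<in> open_edges (v # p)}"
  have Y: "Y \<subseteq> ?V"
  proof
    fix y assume "y \<in> Y"
    then have "count_list (walk_edges (v # p)) (edge y v) \<noteq> 0" by (simp add: Y_def open_edges_def)
    then have "edge y v \<in> set (walk_edges (v # p))" by (metis count_notin)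
    then show "y \<in> ?V" by (rule walk_edges_endpoint)
  qed
  \<comment> \<open>With several open edges the number of choices, at most \<open>n\<close>, is beaten by \<open>L \<ge> n U\<close>.\<close>
  have card_Y: "real (card Y) * ?r \<le> 1 / u v"
  proof (cases "?d = 1")
    case True
    have "card Y \<le> 1" using card_open_neighbours[of v "v # p"] True unfolding Y_def by simp
    then have "real (card Y) * (1 / u v) \<le> 1 * (1 / u v)"
      using u(1)[OF v] by (intro mult_right_mono) auto
    then show ?thesis using True by simp
  next
    case False
    have "card Y \<le> card ?V" using Y by (intro card_mono) auto
    then have "real (card Y) \<le> real n" using card_V by linarith
    then have "real (card Y) * u v \<le> real n * U"
      using u[OF v] by (intro mult_mono) auto
    then have "real (card Y) * u v \<le> L" using L(2) by linarith
    then show ?thesis using False u(1)[OF v] L(1) by (simp add: field_simps)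
  qed
  have "(\<Sum>y<N. of_bool (y \<in> ?V) * (\<theta> * c * L\<^sup>2 + K * L * U)) = real (card ?V) * (\<theta> * c * L\<^sup>2 + K * L * U)"
  proof -
    have "(\<Sum>y<N. of_bool (y \<in> ?V)) = real (card ?V)"
      by (rule sum_of_bool_mem[OF _ p(1)]) simp
    then show ?thesis by (simp only: sum_distrib_right[symmetric])
  qed
  also have "\<dots> \<le> real n * (\<theta> * c * L\<^sup>2 + K * L * U)"
    using card_V \<theta> c K L U by (intro mult_right_mono) auto
  finally have B: "(\<Sum>y<N. of_bool (y \<in> ?V) * (\<theta> * c * L\<^sup>2 + K * L * U)) \<le> real n * (\<theta> * c * L\<^sup>2 + K * L * U)" .
  have C: "(\<Sum>y<N. of_bool (edge y v \<in> open_edges (v # p)) * (1 / \<theta> * ?r)) \<le> 1 / \<theta> * (1 / u v)"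
  proof -
    have "(\<Sum>y<N. of_bool (y \<in> Y)) = real (card Y)"
      using Y p(1) by (intro sum_of_bool_mem) auto
    then have "(\<Sum>y<N. of_bool (edge y v \<in> open_edges (v # p)) * (1 / \<theta> * ?r)) = 1 / \<theta> * (real (card Y) * ?r)"
      unfolding Y_def mem_Collect_eq sum_distrib_right[symmetric] by (simp only: mult_ac)
    also have "\<dots> \<le> 1 / \<theta> * (1 / u v)" using card_Y \<theta> by (intro mult_left_mono) auto
    finally show ?thesis .
  qed
  let ?W = "walk_weight \<theta> K S (v # p)" and ?P = "potential (v # p)"
  have W: "0 \<le> ?W" using \<theta> K S(1) by (intro walk_weight_nonneg) auto
  have P: "0 \<le> ?P" using potential_ge_1[of "v # p"] by simp
  have "(\<Sum>y<N. walk_weight \<theta> K S (y # v # p) * potential (y # v # p))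
    \<le> (\<Sum>y<N. ?W * (?P * (\<theta> * (S (edge y v) * u y) + of_bool (y \<in> ?V) * (\<theta> * c * L\<^sup>2 + K * L * U)
       + of_bool (edge y v \<in> open_edges (v # p)) * (1 / \<theta> * ?r))))"
  proof (rule sum_mono)
    fix y assume "y \<in> {..<N}"
    then have y: "y < N" by simp
    show "walk_weight \<theta> K S (y # v # p) * potential (y # v # p) \<le> ?W * (?P * (\<theta> * (S (edge y v) * u y) + of_bool (y \<in> ?V) * (\<theta> * c * L\<^sup>2 + K * L * U)
       + of_bool (edge y v \<in> open_edges (v # p)) * (1 / \<theta> * ?r)))"
      using mult_left_mono[OF potential_step[OF v y, of p] W] by (simp only: walk_weight.simps mult.assoc)
  qed
  also have "\<dots> = ?W * ?P * (\<theta> * (\<Sum>y<N. S (edge y v) * u y) + (\<Sum>y<N. of_bool (y \<in> ?V) * (\<theta> * c * L\<^sup>2 + K * L * U))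
      + (\<Sum>y<N. of_bool (edge y v \<in> open_edges (v # p)) * (1 / \<theta> * ?r)))"
    by (simp only: sum_distrib_left sum.distrib[symmetric] mult.assoc)
  also have "\<dots> \<le> ?W * ?P * (\<theta> * (\<Sum>y<N. S (edge y v) * u y) + real n * (\<theta> * c * L\<^sup>2 + K * L * U) + 1 / \<theta> * (1 / u v))"
    using W P B C \<theta> by (intro mult_left_mono add_mono) auto
  also have "\<theta> * (\<Sum>y<N. S (edge y v) * u y) + real n * (\<theta> * c * L\<^sup>2 + K * L * U) + 1 / \<theta> * (1 / u v)
      = 1 / \<theta> * (1 / u v + \<theta>\<^sup>2 * (\<Sum>y<N. S (edge y v) * u y) + (\<theta>\<^sup>2 * real n * c * L\<^sup>2 + \<theta> * real n * K * L * U))"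
    using \<theta> by (simp add: field_simps power2_eq_square)
  also have "?W * ?P * \<dots> \<le> ?W * ?P * (1 / \<theta> * 1)"
    using W P \<theta> dyson[OF v] by (intro mult_left_mono) auto
  finally show ?thesis by (simp add: mult_ac)
qed

lemma sum_walk_weight_le:
  assumes "m \<le> n"
  shows "(\<Sum>p\<in>walks N m. walk_weight \<theta> K S p) \<le> real N * U * (1 / \<theta>) ^ m"
proof -
  have "(\<Sum>p\<in>walks N m. walk_weight \<theta> K S p * potential p) \<le> real N * U * (1 / \<theta>) ^ m"
    using assms
  proof (induction m)
    case 0
    have "potential [x] \<le> U" if x: "x < N" for x
    proof -
      have sl: "slots [x] w = of_bool (w = x)" for w
        by (simp add: slots_def open_degree_def open_edges_def)
      have "potential [x] = (\<Prod>w<N. if w = x then u x else 1)"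
        unfolding potential_def sl by (intro prod.cong) (auto simp: site_potential_def)
      then show ?thesis using x u(2) by (simp add: prod.delta)
    qed
    then show ?case using sum_bounded_above[of "{..<N}" "\<lambda>x. potential [x]" U] by (simp add: sum_walks_0)
  next
    case (Suc m)
    have "(\<Sum>p\<in>walks N (Suc m). walk_weight \<theta> K S p * potential p)
        \<le> (\<Sum>p\<in>walks N m. 1 / \<theta> * (walk_weight \<theta> K S p * potential p))"
      unfolding sum_walks_Suc
    proof (rule sum_mono)
      fix p assume "p \<in> walks N m"
      then obtain v q where "p = v # q" "set (v # q) \<subseteq> {..<N}" "length (v # q) \<le> n"
        using Suc.prems by (cases p) (auto simp: walks_def)
      then show "(\<Sum>y<N. walk_weight \<theta> K S (y # p) * potential (y # p)) \<le> 1 / \<theta> * (walk_weight \<theta> K S p * potential p)"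
        using sum_potential_step by simp
    qed
    also have "\<dots> \<le> 1 / \<theta> * (real N * U * (1 / \<theta>) ^ m)"
      unfolding sum_distrib_left[symmetric] using Suc \<theta> by (intro mult_left_mono) auto
    finally show ?case by (simp add: mult_ac)
  qed
  moreover have "(\<Sum>p\<in>walks N m. walk_weight \<theta> K S p) \<le> (\<Sum>p\<in>walks N m. walk_weight \<theta> K S p * potential p)"
  proof (rule sum_mono)
    fix p
    have "0 \<le> walk_weight \<theta> K S p" using \<theta> K S(1) by (intro walk_weight_nonneg) auto
    then show "walk_weight \<theta> K S p \<le> walk_weight \<theta> K S p * potential p"
      using mult_left_mono[OF potential_ge_1[of p]] by fastforce
  qed
  ultimately show ?thesis by linarith
qed

end

section \<open>Traces of powers as sums over walks\<close>

fun walk_prod :: "(nat \<Rightarrow> nat \<Rightarrow> complex) \<Rightarrow> nat list \<Rightarrow> complex" where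
  "walk_prod A (y # v # p) = A y v * walk_prod A (v # p)"
| "walk_prod A _ = 1"

text \<open>
  Entries of the matrix power \<open>A^n\<close> for a matrix given by its entries; no dimension is attached to
  \<open>A\<close>, which lets truncated and original matrices be compared entry by entry.
\<close>
fun entry_pow :: "nat \<Rightarrow> (nat \<Rightarrow> nat \<Rightarrow> complex) \<Rightarrow> nat \<Rightarrow> nat \<Rightarrow> nat \<Rightarrow> complex" where
  "entry_pow N A 0 x y = of_bool (x = y)"
| "entry_pow N A (Suc n) x y = (\<Sum>z<N. A x z * entry_pow N A n z y)"

lemma sum_of_bool_mult:
  fixes f :: "nat \<Rightarrow> complex"
  assumes "x < N"
  shows "(\<Sum>z<N. of_bool (x = z) * f z) = f x"
proof -
  have "(\<Sum>z<N. of_bool (x = z) * f z) = (\<Sum>z<N. if z = x then f z else 0)"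
    by (intro sum.cong) auto
  then show ?thesis using assms by (simp add: sum.delta)
qed

lemma entry_pow_add:
  assumes "x < N"
  shows "entry_pow N A (m + n) x y = (\<Sum>z<N. entry_pow N A m x z * entry_pow N A n z y)"
  using assms
proof (induction m arbitrary: x)
  case 0
  then show ?case using sum_of_bool_mult[OF 0] by simp
next
  case (Suc m)
  have "entry_pow N A (Suc m + n) x y = (\<Sum>w<N. A x w * (\<Sum>z<N. entry_pow N A m w z * entry_pow N A n z y))"
    using Suc.IH by simp
  also have "\<dots> = (\<Sum>z<N. entry_pow N A (Suc m) x z * entry_pow N A n z y)"
    by (simp add: sum_distrib_left sum_distrib_right mult.assoc) (rule sum.swap)
  finally show ?case .
qed

lemma entry_pow_hermitian:
  assumes A: "\<And>x y. x < N \<Longrightarrow> y < N \<Longrightarrow> A y x = cnj (A x y)" and "x < N" "y < N"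
  shows "entry_pow N A n y x = cnj (entry_pow N A n x y)"
  using assms(2,3)
proof (induction n arbitrary: x y)
  case 0
  then show ?case by auto
next
  case (Suc n)
  have one: "entry_pow N A 1 z y = A z y" for z
  proof -
    have "entry_pow N A 1 z y = (\<Sum>w<N. of_bool (y = w) * A z w)" by (auto intro!: sum.cong)
    then show ?thesis by (simp only: sum_of_bool_mult[OF Suc.prems(2)])
  qed
  have "entry_pow N A (n + 1) x y = (\<Sum>z<N. entry_pow N A n x z * A z y)"
    unfolding entry_pow_add[OF Suc.prems(1)] one ..
  then have "cnj (entry_pow N A (Suc n) x y) = (\<Sum>z<N. cnj (entry_pow N A n x z) * cnj (A z y))"
    by simp
  also have "\<dots> = (\<Sum>z<N. A y z * entry_pow N A n z x)"
  proof (rule sum.cong[OF refl])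
    fix z assume "z \<in> {..<N}"
    then have z: "z < N" by simp
    have "entry_pow N A n z x = cnj (entry_pow N A n x z)" "A y z = cnj (A z y)"
      by (rule Suc.IH[OF Suc.prems(1) z], rule A[OF z Suc.prems(2)])
    then show "cnj (entry_pow N A n x z) * cnj (A z y) = A y z * entry_pow N A n z x" by (simp only: mult.commute)
  qed
  finally show ?case by simp
qed

lemma entry_pow_eigenvector:
  assumes "\<And>x. x < N \<Longrightarrow> (\<Sum>y<N. A x y * v y) = l * v x" and "x < N"
  shows "(\<Sum>y<N. entry_pow N A n x y * v y) = l ^ n * v x"
  using assms(2)
proof (induction n arbitrary: x)
  case 0
  then show ?case using sum_of_bool_mult[OF 0] by simp
next
  case (Suc n)
  have "(\<Sum>y<N. entry_pow N A (Suc n) x y * v y) = (\<Sum>z<N. A x z * (\<Sum>y<N. entry_pow N A n z y * v y))"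
    by (simp add: sum_distrib_left sum_distrib_right mult.assoc) (rule sum.swap)
  also have "\<dots> = l ^ n * (\<Sum>z<N. A x z * v z)"
    using Suc.IH by (simp add: sum_distrib_left mult_ac)
  finally show ?case using assms(1)[OF Suc.prems] by simp
qed

text \<open>
  The weight \<open>g\<close> of the two ends is general because in the induction the new end is summed against the old one.
\<close>
lemma sum_walk_prod:
  "(\<Sum>p\<in>walks N n. g (hd p) (last p) * walk_prod A p) = (\<Sum>x<N. \<Sum>y<N. g x y * entry_pow N A n x y)"
proof (induction n arbitrary: g)
  case 0
  have "(\<Sum>x<N. \<Sum>y<N. g x y * entry_pow N A 0 x y) = (\<Sum>x<N. g x x)"
  proof (rule sum.cong[OF refl])
    fix x assume "x \<in> {..<N}"
    then have "(\<Sum>y<N. of_bool (x = y) * g x y) = g x x" by (intro sum_of_bool_mult) simp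
    then show "(\<Sum>y<N. g x y * entry_pow N A 0 x y) = g x x" by (simp only: entry_pow.simps mult.commute)
  qed
  then show ?case by (simp add: sum_walks_0)
next
  case (Suc n)
  have "(\<Sum>p\<in>walks N (Suc n). g (hd p) (last p) * walk_prod A p)
      = (\<Sum>p\<in>walks N n. (\<Sum>y<N. g y (last p) * A y (hd p)) * walk_prod A p)"
    unfolding sum_walks_Suc
  proof (rule sum.cong[OF refl])
    fix p assume "p \<in> walks N n"
    then obtain v q where p: "p = v # q" by (cases p) (auto simp: walks_def)
    show "(\<Sum>y<N. g (hd (y # p)) (last (y # p)) * walk_prod A (y # p))
        = (\<Sum>y<N. g y (last p) * A y (hd p)) * walk_prod A p"
      unfolding p sum_distrib_right by (simp add: mult.assoc)
  qed
  also have "\<dots> = (\<Sum>x<N. \<Sum>y<N. (\<Sum>z<N. g z y * A z x) * entry_pow N A n x y)"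
    by (rule Suc.IH[of "\<lambda>x y. \<Sum>z<N. g z y * A z x"])
  also have "\<dots> = (\<Sum>x<N. \<Sum>y<N. \<Sum>z<N. g z y * (A z x * entry_pow N A n x y))"
    by (simp only: sum_distrib_right mult.assoc)
  also have "\<dots> = (\<Sum>y<N. \<Sum>x<N. \<Sum>z<N. g z y * (A z x * entry_pow N A n x y))"
    by (rule sum.swap)
  also have "\<dots> = (\<Sum>y<N. \<Sum>z<N. \<Sum>x<N. g z y * (A z x * entry_pow N A n x y))"
    by (intro sum.cong refl sum.swap)
  also have "\<dots> = (\<Sum>z<N. \<Sum>y<N. \<Sum>x<N. g z y * (A z x * entry_pow N A n x y))"
    by (rule sum.swap)
  finally show ?case by (simp only: sum_distrib_left entry_pow.simps)
qed

text \<open>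
  The squared Frobenius norm of \<open>A^k\<close>, which is the trace of \<open>A^(2k)\<close> for hermitian \<open>A\<close>.  In this form
  it dominates eigenvalues by the Cauchy-Schwarz inequality alone, without diagonalization.
\<close>
definition frobenius_pow :: "nat \<Rightarrow> nat \<Rightarrow> (nat \<Rightarrow> nat \<Rightarrow> complex) \<Rightarrow> real" where
  "frobenius_pow N k A = (\<Sum>x<N. \<Sum>y<N. (cmod (entry_pow N A k x y))\<^sup>2)"

lemma frobenius_pow_eq_walks:
  assumes A: "\<And>x y. x < N \<Longrightarrow> y < N \<Longrightarrow> A y x = cnj (A x y)"
  shows "complex_of_real (frobenius_pow N k A)
    = (\<Sum>p\<in>walks N (2 * k). of_bool (hd p = last p) * walk_prod A p)"
proof -
  have "(\<Sum>p\<in>walks N (2 * k). of_bool (hd p = last p) * walk_prod A p)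
      = (\<Sum>x<N. \<Sum>y<N. of_bool (x = y) * entry_pow N A (2 * k) x y)"
    by (rule sum_walk_prod)
  also have "\<dots> = (\<Sum>x<N. entry_pow N A (k + k) x x)"
    unfolding mult_2 by (intro sum.cong refl sum_of_bool_mult) simp
  also have "\<dots> = (\<Sum>x<N. \<Sum>y<N. entry_pow N A k x y * cnj (entry_pow N A k x y))"
  proof (rule sum.cong[OF refl])
    fix x assume "x \<in> {..<N}"
    then have x: "x < N" by simp
    show "entry_pow N A (k + k) x x = (\<Sum>y<N. entry_pow N A k x y * cnj (entry_pow N A k x y))"
      unfolding entry_pow_add[OF x]
    proof (rule sum.cong[OF refl])
      fix y assume "y \<in> {..<N}"
      then have y: "y < N" by simp
      have "entry_pow N A k y x = cnj (entry_pow N A k x y)" by (rule entry_pow_hermitian[OF A x y])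
      then show "entry_pow N A k x y * entry_pow N A k y x = entry_pow N A k x y * cnj (entry_pow N A k x y)" by (rule arg_cong)
    qed
  qed
  finally show ?thesis by (simp only: frobenius_pow_def of_real_sum complex_norm_square)
qed

lemma eigenvalue_pow_le_frobenius_pow:
  fixes l :: real
  assumes ev: "\<And>x. x < N \<Longrightarrow> (\<Sum>y<N. A x y * v y) = complex_of_real l * v x"
    and nz: "x0 < N" "v x0 \<noteq> 0"
  shows "l ^ (2 * k) \<le> frobenius_pow N k A"
proof -
  define s where "s = (\<Sum>y<N. (cmod (v y))\<^sup>2)"
  have "(cmod (v x0))\<^sup>2 \<le> s" unfolding s_def using nz by (intro member_le_sum) auto
  moreover have "0 < (cmod (v x0))\<^sup>2" using nz by simp
  ultimately have s: "0 < s" by linarith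
  have "(cmod (complex_of_real l ^ k * v x))\<^sup>2 = l ^ (2 * k) * (cmod (v x))\<^sup>2" for x
    by (simp only: norm_mult norm_power norm_of_real power_mult_distrib power_even_eq power_abs[symmetric] power2_abs abs_power2)
  then have "l ^ (2 * k) * s = (\<Sum>x<N. (cmod (complex_of_real l ^ k * v x))\<^sup>2)"
    by (simp only: s_def sum_distrib_left)
  also have "\<dots> \<le> (\<Sum>x<N. (\<Sum>y<N. (cmod (entry_pow N A k x y))\<^sup>2) * s)"
  proof (rule sum_mono)
    fix x assume "x \<in> {..<N}"
    then have "complex_of_real l ^ k * v x = (\<Sum>y<N. entry_pow N A k x y * v y)"
      using entry_pow_eigenvector[OF ev, of x k] by simp
    also have "cmod \<dots> \<le> (\<Sum>y<N. cmod (entry_pow N A k x y) * cmod (v y))"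
      by (rule order_trans[OF norm_sum]) (simp add: norm_mult)
    finally have "(cmod (complex_of_real l ^ k * v x))\<^sup>2 \<le> (\<Sum>y<N. cmod (entry_pow N A k x y) * cmod (v y))\<^sup>2"
      by (intro power_mono) auto
    also have "\<dots> \<le> (\<Sum>y<N. (cmod (entry_pow N A k x y))\<^sup>2) * s"
      unfolding s_def by (rule Cauchy_Schwarz_ineq_sum)
    finally show "(cmod (complex_of_real l ^ k * v x))\<^sup>2 \<le> (\<Sum>y<N. (cmod (entry_pow N A k x y))\<^sup>2) * s" .
  qed
  also have "\<dots> = frobenius_pow N k A * s" by (simp add: frobenius_pow_def sum_distrib_right)
  finally show ?thesis using s by simp
qed

section \<open>Expectations of walk products\<close>

definition hermitian_entries :: "nat \<Rightarrow> (nat \<Rightarrow> nat \<Rightarrow> complex) \<Rightarrow> bool" where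
  "hermitian_entries N A \<longleftrightarrow> (\<forall>x<N. \<forall>y<N. A y x = cnj (A x y))"

text \<open>
  Grouping the factors of a walk by undirected edges, with \<open>f e\<close> uses in one direction and \<open>b e\<close>
  in the other.  The exponents do not depend on the matrix, which is what independence of
  the entries on and above the diagonal requires.
\<close>
lemma walk_prod_eq_prod:
  assumes "set p \<subseteq> {..<N}"
  shows "\<exists>f b. (\<forall>e. f e + b e = count_list (walk_edges p) e) \<and>
    (\<forall>A. hermitian_entries N A \<longrightarrow> walk_prod A p =
      (\<Prod>e\<in>{(x, y). x \<le> y \<and> y < N}. A (fst e) (snd e) ^ f e * cnj (A (fst e) (snd e)) ^ b e))"
  using assms
proof (induction p rule: walk_edges.induct)
  case (1 y v p)
  let ?I = "{(x, y). x \<le> y \<and> y < N}"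
  have fin: "finite ?I" by (rule finite_subset[of _ "{..<N} \<times> {..<N}"]) auto
  have "set (v # p) \<subseteq> {..<N}" using 1(2) by simp
  from 1(1)[OF this] obtain f b where fb: "\<forall>e. f e + b e = count_list (walk_edges (v # p)) e"
    "\<forall>A. hermitian_entries N A \<longrightarrow>
      walk_prod A (v # p) = (\<Prod>e\<in>?I. A (fst e) (snd e) ^ f e * cnj (A (fst e) (snd e)) ^ b e)"
    by blast
  have yv: "y < N" "v < N" using 1(2) by auto
  let ?e = "edge y v"
  have e: "?e \<in> ?I" using yv by (auto simp: edge_def)
  define f' where "f' = (if y \<le> v then f(?e := Suc (f ?e)) else f)"
  define b' where "b' = (if y \<le> v then b else b(?e := Suc (b ?e)))"
  have cnt: "f' e + b' e = count_list (walk_edges (y # v # p)) e" for e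
    using fb(1)[rule_format, of e] by (simp add: f'_def b'_def)
  have "walk_prod A (y # v # p) = (\<Prod>e\<in>?I. A (fst e) (snd e) ^ f' e * cnj (A (fst e) (snd e)) ^ b' e)"
    if A: "hermitian_entries N A" for A
  proof -
    have "A (fst e) (snd e) ^ f' e * cnj (A (fst e) (snd e)) ^ b' e
        = (if e = ?e then A y v else 1) * (A (fst e) (snd e) ^ f e * cnj (A (fst e) (snd e)) ^ b e)" for e
    proof (cases "e = ?e")
      case True
      show ?thesis
      proof (cases "y \<le> v")
        case le: True
        then show ?thesis using True by (simp add: f'_def b'_def edge_def mult_ac)
      next
        case False
        moreover have "cnj (A v y) = A y v"
          using A yv unfolding hermitian_entries_def by (metis complex_cnj_cnj)
        ultimately show ?thesis using True by (simp add: f'_def b'_def edge_def mult_ac min_def max_def)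
      qed
    qed (simp add: f'_def b'_def)
    then have "(\<Prod>e\<in>?I. A (fst e) (snd e) ^ f' e * cnj (A (fst e) (snd e)) ^ b' e)
      = (\<Prod>e\<in>?I. if e = ?e then A y v else 1) * walk_prod A (v # p)"
      by (simp only: prod.distrib fb(2)[rule_format, OF A])
    also have "(\<Prod>e\<in>?I. if e = ?e then A y v else 1) = A y v"
      using e fin by (simp only: prod.delta if_True)
    finally show ?thesis by simp
  qed
  then show ?case using cnt by blast
qed (rule exI[of _ "\<lambda>_. 0"], rule exI[of _ "\<lambda>_. 0"], simp)+

lemma prod_step_factor:
  assumes "0 < \<theta>"
  shows "(\<Prod>j<Suc (Suc m). step_factor \<theta> K S e j) = S e * K ^ m"
proof -
  have "(\<Prod>j<Suc (Suc m). step_factor \<theta> K S e j)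
      = step_factor \<theta> K S e 0 * (step_factor \<theta> K S e 1 * (\<Prod>j<m. step_factor \<theta> K S e (Suc (Suc j))))"
    by (simp only: prod.lessThan_Suc_shift One_nat_def comp_def mult.assoc)
  also have "\<dots> = S e * K ^ m" using assms by (simp add: step_factor_def)
  finally show ?thesis .
qed

context prob_space
begin

lemma norm_expectation_edge_moment:
  fixes X :: "'a \<Rightarrow> complex"
  assumes [measurable]: "X \<in> borel_measurable M" and bound: "\<And>\<omega>. \<omega> \<in> space M \<Longrightarrow> cmod (X \<omega>) \<le> K"
    and mean: "cmod (expectation X) \<le> \<theta> * S e"
    and var: "(\<integral>\<omega>. (cmod (X \<omega>))\<^sup>2 \<partial>M) \<le> S e" and \<theta>: "0 < \<theta>" and K: "0 \<le> K"
  shows "cmod (\<integral>\<omega>. X \<omega> ^ f * cnj (X \<omega>) ^ b \<partial>M) \<le> (\<Prod>j<f + b. step_factor \<theta> K S e j)"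
proof -
  consider "f + b = 0" | "f + b = 1" | m where "f + b = Suc (Suc m)"
    by (metis One_nat_def not0_implies_Suc)
  then show ?thesis
  proof cases
    case 1
    then have "f = 0" "b = 0" by simp_all
    then show ?thesis by (simp add: prob_space)
  next
    case 2
    then have "(f = 1 \<and> b = 0) \<or> (f = 0 \<and> b = 1)" by auto
    then show ?thesis using mean by (auto simp: step_factor_def)
  next
    case 3
    have int2: "integrable M (\<lambda>\<omega>. (cmod (X \<omega>))\<^sup>2)"
      by (rule integrable_const_bound[of _ "K\<^sup>2"]) (auto intro!: AE_I2 power_mono bound)
    have "cmod (\<integral>\<omega>. X \<omega> ^ f * cnj (X \<omega>) ^ b \<partial>M) \<le> (\<integral>\<omega>. cmod (X \<omega> ^ f * cnj (X \<omega>) ^ b) \<partial>M)"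
      by (rule integral_norm_bound)
    also have "\<dots> = (\<integral>\<omega>. cmod (X \<omega>) ^ Suc (Suc m) \<partial>M)"
      by (simp add: norm_mult norm_power power_add[symmetric] 3 del: power_Suc)
    also have "\<dots> \<le> (\<integral>\<omega>. (cmod (X \<omega>))\<^sup>2 * K ^ m \<partial>M)"
    proof (rule integral_mono)
      show "integrable M (\<lambda>\<omega>. cmod (X \<omega>) ^ Suc (Suc m))"
      proof (rule integrable_const_bound[of _ "K ^ Suc (Suc m)"])
        show "AE \<omega> in M. norm (cmod (X \<omega>) ^ Suc (Suc m)) \<le> K ^ Suc (Suc m)"
          unfolding real_norm_def power_abs abs_norm_cancel
          by (intro AE_I2 power_mono bound norm_ge_zero)
      qed measurable
      show "integrable M (\<lambda>\<omega>. (cmod (X \<omega>))\<^sup>2 * K ^ m)" using int2 by simp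
      fix \<omega> assume "\<omega> \<in> space M"
      then have "cmod (X \<omega>) ^ m \<le> K ^ m" using bound by (intro power_mono) auto
      then have "(cmod (X \<omega>))\<^sup>2 * cmod (X \<omega>) ^ m \<le> (cmod (X \<omega>))\<^sup>2 * K ^ m" by (intro mult_left_mono) auto
      then show "cmod (X \<omega>) ^ Suc (Suc m) \<le> (cmod (X \<omega>))\<^sup>2 * K ^ m" by (simp add: power2_eq_square mult.assoc)
    qed
    also have "\<dots> \<le> S e * K ^ m" using var K by (simp add: mult_right_mono)
    finally show ?thesis unfolding 3 prod_step_factor[OF \<theta>] .
  qed
qed

lemma norm_expectation_walk_prod:
  fixes X :: "'a \<Rightarrow> nat \<Rightarrow> nat \<Rightarrow> complex"
  assumes indep: "indep_vars (\<lambda>_. borel) (\<lambda>(x, y) \<omega>. X \<omega> x y) {(x, y). x \<le> y \<and> y < N}"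
    and herm: "\<And>\<omega> x y. \<omega> \<in> space M \<Longrightarrow> x < N \<Longrightarrow> y < N \<Longrightarrow> X \<omega> y x = cnj (X \<omega> x y)"
    and bound: "\<And>\<omega> x y. \<omega> \<in> space M \<Longrightarrow> x \<le> y \<Longrightarrow> y < N \<Longrightarrow> cmod (X \<omega> x y) \<le> K"
    and mean: "\<And>x y. x \<le> y \<Longrightarrow> y < N \<Longrightarrow> cmod (\<integral>\<omega>. X \<omega> x y \<partial>M) \<le> \<theta> * S (x, y)"
    and var: "\<And>x y. x \<le> y \<Longrightarrow> y < N \<Longrightarrow> (\<integral>\<omega>. (cmod (X \<omega> x y))\<^sup>2 \<partial>M) \<le> S (x, y)"
    and \<theta>: "0 < \<theta>" and K: "0 \<le> K" and p: "set p \<subseteq> {..<N}"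
  shows "integrable M (\<lambda>\<omega>. walk_prod (X \<omega>) p)"
    and "cmod (\<integral>\<omega>. walk_prod (X \<omega>) p \<partial>M) \<le> walk_weight \<theta> K S p"
proof -
  let ?I = "{(x, y). x \<le> y \<and> y < N}"
  have fin: "finite ?I" by (rule finite_subset[of _ "{..<N} \<times> {..<N}"]) auto
  from walk_prod_eq_prod[OF p] obtain f b where
    f: "\<forall>e. f e + b e = count_list (walk_edges p) e" and
    b: "\<forall>A. hermitian_entries N A \<longrightarrow>
      walk_prod A p = (\<Prod>e\<in>?I. A (fst e) (snd e) ^ f e * cnj (A (fst e) (snd e)) ^ b e)"
    by blast
  define Y where "Y = (\<lambda>e \<omega>. X \<omega> (fst e) (snd e) ^ f e * cnj (X \<omega> (fst e) (snd e)) ^ b e)"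
  have indepY: "indep_vars (\<lambda>_. borel) Y ?I"
  proof -
    have "indep_vars (\<lambda>_. borel) (\<lambda>e \<omega>. (\<lambda>z. z ^ f e * cnj z ^ b e) ((\<lambda>(x, y) \<omega>. X \<omega> x y) e \<omega>)) ?I"
      by (rule indep_vars_compose2[OF indep]) (auto intro!: borel_measurable_continuous_onI continuous_intros)
    then show ?thesis by (simp add: Y_def case_prod_unfold)
  qed
  have rv: "(\<lambda>\<omega>. X \<omega> x y) \<in> borel_measurable M" if "x \<le> y" "y < N" for x y
    using indep that unfolding indep_vars_def by auto
  have intY: "integrable M (Y e)" if "e \<in> ?I" for e
  proof (rule integrable_const_bound[of _ "K ^ (f e + b e)"])
    show "Y e \<in> borel_measurable M" using indepY that unfolding indep_vars_def by auto
    show "AE \<omega> in M. norm (Y e \<omega>) \<le> K ^ (f e + b e)"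
    proof (rule AE_I2)
      fix \<omega> assume "\<omega> \<in> space M"
      then have "cmod (X \<omega> (fst e) (snd e)) \<le> K" using bound that by auto
      then have "cmod (X \<omega> (fst e) (snd e)) ^ (f e + b e) \<le> K ^ (f e + b e)" by (intro power_mono) auto
      then show "norm (Y e \<omega>) \<le> K ^ (f e + b e)"
        by (simp add: Y_def norm_mult norm_power power_add)
    qed
  qed
  have walk: "walk_prod (X \<omega>) p = (\<Prod>e\<in>?I. Y e \<omega>)" if "\<omega> \<in> space M" for \<omega>
  proof -
    have "hermitian_entries N (X \<omega>)" unfolding hermitian_entries_def using herm[OF that] by blast
    then show ?thesis unfolding Y_def by (rule b[rule_format])
  qed
  show "integrable M (\<lambda>\<omega>. walk_prod (X \<omega>) p)"
    using indep_vars_integrable[OF fin indepY intY]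
    by (subst Bochner_Integration.integrable_cong[OF refl walk]) auto
  have "(\<integral>\<omega>. walk_prod (X \<omega>) p \<partial>M) = (\<integral>\<omega>. (\<Prod>e\<in>?I. Y e \<omega>) \<partial>M)"
    by (intro Bochner_Integration.integral_cong refl walk)
  also have "\<dots> = (\<Prod>e\<in>?I. expectation (Y e))"
    by (rule indep_vars_lebesgue_integral[OF fin indepY intY])
  finally have "cmod (\<integral>\<omega>. walk_prod (X \<omega>) p \<partial>M) = (\<Prod>e\<in>?I. cmod (expectation (Y e)))"
    by (simp add: prod_norm)
  also have "\<dots> \<le> (\<Prod>e\<in>?I. \<Prod>j<f e + b e. step_factor \<theta> K S e j)"
  proof (intro prod_mono conjI)
    fix e assume "e \<in> ?I"
    then obtain x y where e: "e = (x, y)" "x \<le> y" "y < N" by auto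
    show "cmod (expectation (Y e)) \<le> (\<Prod>j<f e + b e. step_factor \<theta> K S e j)"
      unfolding Y_def e(1) fst_conv snd_conv
      by (rule norm_expectation_edge_moment[of "\<lambda>\<omega>. X \<omega> x y" K \<theta> S "(x, y)"];
          (assumption | rule rv bound mean var \<theta> K e)+)
  qed simp
  also have "\<dots> = walk_weight \<theta> K S p"
    unfolding f[rule_format] by (rule walk_weight_eq_prod[OF fin walk_edges_subset[OF p], symmetric])
  finally show "cmod (\<integral>\<omega>. walk_prod (X \<omega>) p \<partial>M) \<le> walk_weight \<theta> K S p" .
qed

text \<open>
  Nonclosed walks are included on the right-hand side; as the potential of a walk controls all
  continuations at once, nothing is gained by excluding them.
\<close>
lemma expectation_frobenius_pow:
  fixes X :: "'a \<Rightarrow> nat \<Rightarrow> nat \<Rightarrow> complex"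
  assumes indep: "indep_vars (\<lambda>_. borel) (\<lambda>(x, y) \<omega>. X \<omega> x y) {(x, y). x \<le> y \<and> y < N}"
    and herm: "\<And>\<omega> x y. \<omega> \<in> space M \<Longrightarrow> x < N \<Longrightarrow> y < N \<Longrightarrow> X \<omega> y x = cnj (X \<omega> x y)"
    and bound: "\<And>\<omega> x y. \<omega> \<in> space M \<Longrightarrow> x \<le> y \<Longrightarrow> y < N \<Longrightarrow> cmod (X \<omega> x y) \<le> K"
    and mean: "\<And>x y. x \<le> y \<Longrightarrow> y < N \<Longrightarrow> cmod (\<integral>\<omega>. X \<omega> x y \<partial>M) \<le> \<theta> * S (x, y)"
    and var: "\<And>x y. x \<le> y \<Longrightarrow> y < N \<Longrightarrow> (\<integral>\<omega>. (cmod (X \<omega> x y))\<^sup>2 \<partial>M) \<le> S (x, y)"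
    and \<theta>: "0 < \<theta>" and K: "0 \<le> K" and S: "\<And>e. 0 \<le> S e"
  shows "integrable M (\<lambda>\<omega>. frobenius_pow N k (X \<omega>))"
    and "expectation (\<lambda>\<omega>. frobenius_pow N k (X \<omega>)) \<le> (\<Sum>p\<in>walks N (2 * k). walk_weight \<theta> K S p)"
proof -
  let ?W = "walks N (2 * k)"
  have w: "integrable M (\<lambda>\<omega>. walk_prod (X \<omega>) p)"
    "cmod (\<integral>\<omega>. walk_prod (X \<omega>) p \<partial>M) \<le> walk_weight \<theta> K S p" if "set p \<subseteq> {..<N}" for p
    by (rule norm_expectation_walk_prod[OF indep _ _ _ _ \<theta> K that]; fact herm bound mean var)+
  have pW: "set p \<subseteq> {..<N}" if "p \<in> ?W" for p using that by (simp add: walks_def)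
  have eq: "complex_of_real (frobenius_pow N k (X \<omega>)) = (\<Sum>p\<in>?W. of_bool (hd p = last p) * walk_prod (X \<omega>) p)"
    if "\<omega> \<in> space M" for \<omega>
    using herm[OF that] by (rule frobenius_pow_eq_walks)
  have int: "integrable M (\<lambda>\<omega>. \<Sum>p\<in>?W. of_bool (hd p = last p) * walk_prod (X \<omega>) p)"
    using w(1)[OF pW] by (intro Bochner_Integration.integrable_sum) auto
  have intc: "integrable M (\<lambda>\<omega>. complex_of_real (frobenius_pow N k (X \<omega>)))"
    using int by (subst Bochner_Integration.integrable_cong[OF refl eq]) auto
  then show "integrable M (\<lambda>\<omega>. frobenius_pow N k (X \<omega>))" by (simp only: complex_of_real_integrable_eq)
  have "complex_of_real (expectation (\<lambda>\<omega>. frobenius_pow N k (X \<omega>)))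
      = (\<integral>\<omega>. complex_of_real (frobenius_pow N k (X \<omega>)) \<partial>M)" by simp
  also have "\<dots> = (\<integral>\<omega>. (\<Sum>p\<in>?W. of_bool (hd p = last p) * walk_prod (X \<omega>) p) \<partial>M)"
    by (intro Bochner_Integration.integral_cong refl eq)
  also have "\<dots> = (\<Sum>p\<in>?W. \<integral>\<omega>. of_bool (hd p = last p) * walk_prod (X \<omega>) p \<partial>M)"
    using w(1)[OF pW] by (intro Bochner_Integration.integral_sum) auto
  finally have "complex_of_real (expectation (\<lambda>\<omega>. frobenius_pow N k (X \<omega>)))
      = (\<Sum>p\<in>?W. \<integral>\<omega>. of_bool (hd p = last p) * walk_prod (X \<omega>) p \<partial>M)" .
  then have "\<bar>expectation (\<lambda>\<omega>. frobenius_pow N k (X \<omega>))\<bar> 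
      = cmod (\<Sum>p\<in>?W. \<integral>\<omega>. of_bool (hd p = last p) * walk_prod (X \<omega>) p \<partial>M)"
    by (metis norm_of_real)
  also have "\<dots> \<le> (\<Sum>p\<in>?W. walk_weight \<theta> K S p)"
  proof (rule order_trans[OF norm_sum], rule sum_mono)
    fix p assume "p \<in> ?W"
    then have "cmod (\<integral>\<omega>. walk_prod (X \<omega>) p \<partial>M) \<le> walk_weight \<theta> K S p" by (intro w(2) pW)
    moreover have "0 \<le> walk_weight \<theta> K S p" using \<theta> K S by (intro walk_weight_nonneg) auto
    ultimately show "cmod (\<integral>\<omega>. of_bool (hd p = last p) * walk_prod (X \<omega>) p \<partial>M) \<le> walk_weight \<theta> K S p"
      by (simp add: norm_mult)
  qed
  finally show "expectation (\<lambda>\<omega>. frobenius_pow N k (X \<omega>)) \<le> (\<Sum>p\<in>?W. walk_weight \<theta> K S p)" by linarith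
qed

end

section \<open>Hermitian eigenvalues\<close>

lemma mat_adjoint_entry:
  fixes A :: "complex mat"
  assumes "A \<in> carrier_mat N N" "x < N" "y < N"
  shows "mat_adjoint A $$ (x, y) = cnj (A $$ (y, x))"
  using assms by (simp add: mat_adjoint_def mat_of_rows_def)

lemma hermitian_eigenvalue_real:
  fixes A :: "complex mat"
  assumes A: "A \<in> carrier_mat N N" and herm: "mat_adjoint A = A" and ev: "eigenvalue A l"
  shows "l \<in> \<real>"
proof -
  have sym: "A $$ (x, y) = cnj (A $$ (y, x))" if "x < N" "y < N" for x y
    using mat_adjoint_entry[OF A that] by (simp only: herm)
  obtain v where v: "v \<in> carrier_vec N" "v \<noteq> 0\<^sub>v N" "A *\<^sub>v v = l \<cdot>\<^sub>v v"
    using ev A unfolding eigenvalue_def eigenvector_def by auto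
  have av: "(\<Sum>y<N. A $$ (x, y) * v $ y) = l * v $ x" if x: "x < N" for x
  proof -
    have "(A *\<^sub>v v) $ x = (\<Sum>y<N. A $$ (x, y) * v $ y)"
      using A v(1) x by (auto simp: scalar_prod_def atLeast0LessThan)
    then show ?thesis using v x by simp
  qed
  define s where "s = (\<Sum>x<N. cnj (v $ x) * v $ x)"
  define q where "q = (\<Sum>x<N. \<Sum>y<N. cnj (v $ x) * (A $$ (x, y) * v $ y))"
  have "q = (\<Sum>x<N. cnj (v $ x) * (\<Sum>y<N. A $$ (x, y) * v $ y))"
    by (simp only: q_def sum_distrib_left)
  also have "\<dots> = (\<Sum>x<N. cnj (v $ x) * (l * v $ x))" by (intro sum.cong refl) (simp only: av lessThan_iff)
  also have "\<dots> = l * s" by (simp only: s_def sum_distrib_left mult.left_commute)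
  finally have q: "q = l * s" .
  have "cnj q = (\<Sum>x<N. \<Sum>y<N. v $ x * (cnj (A $$ (x, y)) * cnj (v $ y)))"
    by (simp add: q_def)
  also have "\<dots> = (\<Sum>y<N. \<Sum>x<N. v $ x * (cnj (A $$ (x, y)) * cnj (v $ y)))"
    by (rule sum.swap)
  also have "\<dots> = q"
    unfolding q_def
  proof (intro sum.cong refl)
    fix y x assume "y \<in> {..<N}" "x \<in> {..<N}"
    then have "A $$ (y, x) = cnj (A $$ (x, y))" by (intro sym) auto
    then show "v $ x * (cnj (A $$ (x, y)) * cnj (v $ y)) = cnj (v $ y) * (A $$ (y, x) * v $ x)"
      by (simp only: mult_ac)
  qed
  finally have cq: "cnj q = q" .
  have sr: "s = complex_of_real (\<Sum>x<N. (cmod (v $ x))\<^sup>2)"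
    unfolding s_def of_real_sum complex_norm_square by (simp only: mult.commute)
  obtain x0 where x0: "x0 < N" "v $ x0 \<noteq> 0"
    using v(1,2) by (metis carrier_vecD eq_vecI index_zero_vec)
  have "(cmod (v $ x0))\<^sup>2 \<le> (\<Sum>x<N. (cmod (v $ x))\<^sup>2)"
    using x0 by (intro member_le_sum) auto
  moreover have "0 < (cmod (v $ x0))\<^sup>2" using x0 by simp
  ultimately have "s \<noteq> 0" unfolding sr of_real_eq_0_iff by linarith
  moreover have "cnj s = s" unfolding sr by simp
  ultimately have "cnj l = l" using cq unfolding q by simp
  then show ?thesis by (simp add: Reals_cnj_iff)
qed

lemma lambda_max_eigenvector:
  fixes A :: "complex mat"
  assumes A: "A \<in> carrier_mat N N" and herm: "mat_adjoint A = A" and N: "0 < N"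
  obtains v x0 where "\<And>x. x < N \<Longrightarrow> (\<Sum>y<N. A $$ (x, y) * v y) = complex_of_real (lambda_max A) * v x"
    "x0 < N" "v x0 \<noteq> 0"
proof -
  let ?R = "{r::real. eigenvalue A (complex_of_real r)}"
  have "complex_of_real ` ?R \<subseteq> spectrum A" by (auto simp: spectrum_def)
  then have "finite (complex_of_real ` ?R)" using card_finite_spectrum(1)[OF A] finite_subset by blast
  then have fin: "finite ?R" by (rule finite_imageD) (auto simp: inj_on_def)
  obtain l where "eigenvalue A l" using spectrum_non_empty[OF A N] by (auto simp: spectrum_def)
  moreover from this obtain r where "l = complex_of_real r"
    using hermitian_eigenvalue_real[OF A herm] by (metis Reals_cases)
  ultimately have "?R \<noteq> {}" by auto
  then have "lambda_max A \<in> ?R" unfolding lambda_max_def using Max_in[OF fin] by simp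
  then obtain v where v: "v \<in> carrier_vec N" "v \<noteq> 0\<^sub>v N" "A *\<^sub>v v = complex_of_real (lambda_max A) \<cdot>\<^sub>v v"
    using A unfolding eigenvalue_def eigenvector_def by auto
  obtain x0 where x0: "x0 < N" "v $ x0 \<noteq> 0"
    using v(1,2) by (metis carrier_vecD eq_vecI index_zero_vec)
  have "(\<Sum>y<N. A $$ (x, y) * v $ y) = complex_of_real (lambda_max A) * v $ x" if x: "x < N" for x
  proof -
    have "(A *\<^sub>v v) $ x = (\<Sum>y<N. A $$ (x, y) * v $ y)"
      using A v(1) x by (auto simp: scalar_prod_def atLeast0LessThan)
    then show ?thesis using v x by simp
  qed
  then show ?thesis using that[of "\<lambda>x. v $ x" x0] x0 by blast
qed

section \<open>Truncation\<close>

text \<open>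
  The moment method needs moments of order \<open>log N\<close>, on which there is no uniform control.  With
  \<open>R = \<surd>N\<close>, entries are therefore cut off at \<open>\<surd>R / R = N^(-1/4)\<close>, a level that is exceeded with a
  probability smaller than any power of \<open>N\<close>.
\<close>
definition truncate_entry :: "real \<Rightarrow> complex \<Rightarrow> complex" where
  "truncate_entry K h = (if cmod h \<le> K then h else 0)"

lemma truncate_entry_measurable [measurable]: "truncate_entry K \<in> borel_measurable borel"
  unfolding truncate_entry_def[abs_def] by measurable

lemma norm_truncate_entry: "0 \<le> K \<Longrightarrow> cmod (truncate_entry K h) \<le> K" "cmod (truncate_entry K h) \<le> cmod h"
  by (auto simp: truncate_entry_def)

text \<open>
  Truncation destroys the centering.  The ninth moment shows that the mean becomes at most of order
  \<open>R^(-5) = N^(-5/2)\<close>, which is small compared with the amount \<open>N^(-2)\<close> that can be added to all variances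
  without changing the row sums by more than \<open>1 / N\<close>.
\<close>
lemma (in prob_space) truncation_mean:
  fixes h :: "'a \<Rightarrow> complex" and R :: real
  assumes int: "integrable M h" and mean: "expectation h = 0" and R: "1 \<le> R"
    and mom: "integrable M (\<lambda>\<omega>. (R * cmod (h \<omega>)) ^ 9)"
      "(\<integral>\<omega>. (R * cmod (h \<omega>)) ^ 9 \<partial>M) \<le> C"
  shows "cmod (\<integral>\<omega>. truncate_entry (sqrt R / R) (h \<omega>) \<partial>M) \<le> C / R ^ 5"
proof -
  let ?K = "sqrt R / R"
  note [measurable] = borel_measurable_integrable[OF int]
  have it: "integrable M (\<lambda>\<omega>. truncate_entry ?K (h \<omega>))"
    using norm_truncate_entry(2) by (intro Bochner_Integration.integrable_bound[OF int]) auto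
  have "(\<integral>\<omega>. truncate_entry ?K (h \<omega>) \<partial>M) = - (\<integral>\<omega>. h \<omega> - truncate_entry ?K (h \<omega>) \<partial>M)"
    using int it mean by simp
  then have "cmod (\<integral>\<omega>. truncate_entry ?K (h \<omega>) \<partial>M) = cmod (\<integral>\<omega>. h \<omega> - truncate_entry ?K (h \<omega>) \<partial>M)"
    by (simp only: norm_minus_cancel)
  also have "\<dots> \<le> (\<integral>\<omega>. cmod (h \<omega> - truncate_entry ?K (h \<omega>)) \<partial>M)"
    by (rule integral_norm_bound)
  also have "\<dots> \<le> (\<integral>\<omega>. (R * cmod (h \<omega>)) ^ 9 / R ^ 5 \<partial>M)"
  proof (rule integral_mono)
    show "integrable M (\<lambda>\<omega>. cmod (h \<omega> - truncate_entry ?K (h \<omega>)))" using int it by simp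
    show "integrable M (\<lambda>\<omega>. (R * cmod (h \<omega>)) ^ 9 / R ^ 5)" using mom(1) by simp
    fix \<omega>
    show "cmod (h \<omega> - truncate_entry ?K (h \<omega>)) \<le> (R * cmod (h \<omega>)) ^ 9 / R ^ 5"
    proof (cases "cmod (h \<omega>) \<le> ?K")
      case False
      have R0: "0 < R" using R by simp
      have "sqrt R < R * cmod (h \<omega>)" using False R0 by (simp add: field_simps not_le)
      then have "sqrt R ^ 8 \<le> (R * cmod (h \<omega>)) ^ 8" using R by (intro power_mono) auto
      moreover have "sqrt R ^ 8 = R ^ 4"
        using R power_mult[of "sqrt R" 2 4] by simp
      ultimately have "R ^ 4 * (R * cmod (h \<omega>)) \<le> (R * cmod (h \<omega>)) ^ 8 * (R * cmod (h \<omega>))"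
        using R0 by (intro mult_right_mono) auto
      then have "R ^ 5 * cmod (h \<omega>) \<le> (R * cmod (h \<omega>)) ^ 9"
        by (simp add: eval_nat_numeral mult_ac)
      then show ?thesis using False R0 by (simp add: truncate_entry_def field_simps)
    qed (use R in \<open>simp add: truncate_entry_def\<close>)
  qed
  also have "\<dots> \<le> C / R ^ 5" using mom(2) R by (simp add: divide_right_mono)
  finally show ?thesis .
qed

lemma (in prob_space) truncation_tail:
  fixes h :: "'a \<Rightarrow> complex" and R :: real
  assumes R: "1 \<le> R"
    and mom: "integrable M (\<lambda>\<omega>. (R * cmod (h \<omega>)) ^ q)"
      "(\<integral>\<omega>. (R * cmod (h \<omega>)) ^ q \<partial>M) \<le> C"
    and h [measurable]: "h \<in> borel_measurable M"
  shows "prob {\<omega>\<in>space M. sqrt R / R < cmod (h \<omega>)} \<le> C / sqrt R ^ q"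
proof -
  have "prob {\<omega>\<in>space M. sqrt R / R < cmod (h \<omega>)} \<le> prob {\<omega>\<in>space M. sqrt R ^ q \<le> (R * cmod (h \<omega>)) ^ q}"
  proof (rule finite_measure_mono)
    show "{\<omega>\<in>space M. sqrt R / R < cmod (h \<omega>)} \<subseteq> {\<omega>\<in>space M. sqrt R ^ q \<le> (R * cmod (h \<omega>)) ^ q}"
    proof safe
      fix \<omega> assume "sqrt R / R < cmod (h \<omega>)"
      then have "sqrt R < R * cmod (h \<omega>)" using R by (simp add: field_simps)
      then show "sqrt R ^ q \<le> (R * cmod (h \<omega>)) ^ q" using R by (intro power_mono) auto
    qed
  qed measurable
  also have "\<dots> \<le> (\<integral>\<omega>. (R * cmod (h \<omega>)) ^ q \<partial>M) / sqrt R ^ q"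
    using R by (intro integral_Markov_inequality_measure[OF mom(1), of "{}"]) auto
  also have "\<dots> \<le> C / sqrt R ^ q" using mom(2) R by (simp add: divide_right_mono)
  finally show ?thesis .
qed

section \<open>The tail of the largest eigenvalue\<close>

text \<open>
  Lowering the weight per step from \<open>s / \<sigma>\<close> to \<open>\<theta>\<close> leaves room to multiply the supersolution by
  \<open>1 + \<kappa>\<close>, which turns it into a strict supersolution.  The factor is needed: where \<open>r = 1\<close>,
  decreasing the weight alone gives no margin.  The constant \<open>\<kappa>\<close> depends only on \<open>\<epsilon>\<close> and the upper
  bound for \<open>\<sigma>\<^sup>2\<close>, because \<open>\<sigma> / s \<le> 4 \<surd>Cs\<close>.
\<close>
lemma scaled_supersolution_margin:
  fixes \<sigma>2 s \<epsilon> Cs rv T :: real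
  assumes \<epsilon>: "0 < \<epsilon>" and Cs: "0 \<le> Cs" and \<sigma>: "0 \<le> \<sigma>2" "\<sigma>2 \<le> Cs" and s: "1 / 4 \<le> s" and r: "1 \<le> rv"
    and sup: "s\<^sup>2 * T \<le> \<sigma>2 * (1 - 1 / rv)"
  defines "\<kappa> \<equiv> \<epsilon> / (16 * sqrt Cs + \<epsilon>)" and "\<theta> \<equiv> 1 / (sqrt \<sigma>2 / s + \<epsilon> / 4)"
  shows "1 / ((1 + \<kappa>) * rv) + \<theta>\<^sup>2 * ((1 + \<kappa>) * T) \<le> 1 - \<kappa> / (1 + \<kappa>)"
proof -
  have s0: "0 < s" using s by simp
  have den: "0 < 16 * sqrt Cs + \<epsilon>" using \<epsilon> Cs by (intro add_nonneg_pos) auto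
  have k0: "0 < \<kappa>" using \<epsilon> den by (simp add: \<kappa>_def)
  have a0: "0 \<le> sqrt \<sigma>2 / s" using \<sigma> s0 by simp
  have th: "0 < \<theta>" unfolding \<theta>_def using a0 \<epsilon> by (intro divide_pos_pos add_nonneg_pos) auto
  have "sqrt \<sigma>2 / s \<le> sqrt Cs / (1 / 4)" using \<sigma> s by (intro frac_le) auto
  then have "\<kappa> * (sqrt \<sigma>2 / s) \<le> \<kappa> * (4 * sqrt Cs)" using k0 by (intro mult_left_mono) auto
  also have "\<dots> \<le> \<epsilon> / 4"
  proof -
    have "\<epsilon> * (16 * sqrt Cs) \<le> \<epsilon> * (16 * sqrt Cs + \<epsilon>)" using \<epsilon> by (intro mult_left_mono) auto
    then show ?thesis using den by (simp add: \<kappa>_def field_simps)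
  qed
  finally have "\<kappa> * (sqrt \<sigma>2 / s) \<le> \<epsilon> / 4" .
  moreover have "(1 + \<kappa>) * (sqrt \<sigma>2 / s) = sqrt \<sigma>2 / s + \<kappa> * (sqrt \<sigma>2 / s)" by (simp only: distrib_right mult_1)
  moreover have "1 / \<theta> = sqrt \<sigma>2 / s + \<epsilon> / 4" by (simp add: \<theta>_def)
  ultimately have "(1 + \<kappa>) * (sqrt \<sigma>2 / s) \<le> 1 / \<theta>" by linarith
  then have "(1 + \<kappa>) * (sqrt \<sigma>2 / s) * \<theta> \<le> 1" using th by (simp add: pos_le_divide_eq)
  moreover have "0 \<le> (1 + \<kappa>) * (sqrt \<sigma>2 / s) * \<theta>"
    using k0 a0 th by (intro mult_nonneg_nonneg) auto
  ultimately have "((1 + \<kappa>) * (sqrt \<sigma>2 / s) * \<theta>)\<^sup>2 \<le> 1" by (simp add: power_le_one)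
  then have sq: "(1 + \<kappa>)\<^sup>2 * (\<sigma>2 / s\<^sup>2) * \<theta>\<^sup>2 \<le> 1"
    using \<sigma>(1) by (simp add: power_mult_distrib power_divide)
  have T: "T \<le> \<sigma>2 / s\<^sup>2 * (1 - 1 / rv)"
    using sup s0 by (simp add: field_simps)
  have r1: "0 \<le> 1 - 1 / rv" using r by simp
  have "(1 + \<kappa>) * (\<theta>\<^sup>2 * ((1 + \<kappa>) * T)) = (1 + \<kappa>)\<^sup>2 * \<theta>\<^sup>2 * T" by (simp add: power2_eq_square mult_ac)
  also have "\<dots> \<le> (1 + \<kappa>)\<^sup>2 * \<theta>\<^sup>2 * (\<sigma>2 / s\<^sup>2 * (1 - 1 / rv))" using T by (intro mult_left_mono) auto
  also have "\<dots> = ((1 + \<kappa>)\<^sup>2 * (\<sigma>2 / s\<^sup>2) * \<theta>\<^sup>2) * (1 - 1 / rv)" by (simp only: mult_ac)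
  also have "\<dots> \<le> 1 * (1 - 1 / rv)" using sq r1 by (intro mult_right_mono) auto
  finally have "(1 + \<kappa>) * (\<theta>\<^sup>2 * ((1 + \<kappa>) * T)) \<le> 1 - 1 / rv" by simp
  then have "\<theta>\<^sup>2 * ((1 + \<kappa>) * T) \<le> (1 - 1 / rv) / (1 + \<kappa>)"
    using k0 by (simp only: pos_le_divide_eq add_pos_pos zero_less_one mult.commute[of _ "1 + \<kappa>"])
  moreover have "1 / ((1 + \<kappa>) * rv) = (1 / rv) / (1 + \<kappa>)" by simp
  moreover have "(1 / rv) / (1 + \<kappa>) + (1 - 1 / rv) / (1 + \<kappa>) = 1 / (1 + \<kappa>)"
  proof -
    have "1 / rv + (1 - 1 / rv) = 1" by linarith
    then show ?thesis by (simp only: add_divide_distrib[symmetric])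
  qed
  moreover have "1 - \<kappa> / (1 + \<kappa>) = 1 / (1 + \<kappa>)" using k0 by (simp add: field_simps)
  ultimately show ?thesis by linarith
qed

lemma variance_mat_carrier: "variance_mat M N H \<in> carrier_mat N N"
  by (simp add: variance_mat_def)

lemma variance_mat_nonneg: "x < N \<Longrightarrow> y < N \<Longrightarrow> 0 \<le> variance_mat M N H $$ (x, y)"
  by (simp add: variance_mat_def)

lemma row_norm_variance_mat_le:
  assumes "0 < N" "\<And>x y. x < N \<Longrightarrow> y < N \<Longrightarrow> variance_mat M N H $$ (x, y) \<le> Cs / real N"
  shows "row_norm (variance_mat M N H) \<le> Cs"
proof (rule row_norm_le[OF variance_mat_carrier assms(1)])
  fix x assume x: "x < N"
  have "(\<Sum>y<N. \<bar>variance_mat M N H $$ (x, y)\<bar>) \<le> (\<Sum>y<N. Cs / real N)"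
    using variance_mat_nonneg[OF x, of _ M H] assms(2)[OF x] by (intro sum_mono) simp
  then show "(\<Sum>y<N. \<bar>variance_mat M N H $$ (x, y)\<bar>) \<le> Cs" using assms(1) by simp
qed

text \<open>
  The two error terms are the probability that some entry exceeds the truncation level, and the
  Markov bound for the trace of the power \<open>2k\<close> of the truncated matrix: this trace has
  expectation at most \<open>8 N (\<sigma> / s + \<epsilon> / 4)^(2k)\<close>, and it is at least \<open>(\<sigma> / s + \<epsilon>)^(2k)\<close> if
  \<open>\<lambda>_max\<close> is that large.  The threshold \<open>b\<close> is arbitrary from \<open>\<sigma> / s + \<epsilon>\<close> on, because the events in question
  need not be measurable and so cannot be compared with each other.
\<close>
lemma lambda_max_tail_bound:
  fixes M :: "'a measure"
  assumes N: "1 \<le> N" and wig: "wigner_type M N H" and cen: "centered M N H" and mom: "moment_bounds M N H Cq"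
    and flat: "\<And>x y. x < N \<Longrightarrow> y < N \<Longrightarrow> variance_mat M N H $$ (x, y) \<le> Cs / real N"
    and \<epsilon>: "0 < \<epsilon>" and Cs: "0 \<le> Cs" and s: "1 / 4 \<le> s"
    and r: "\<And>x. x < N \<Longrightarrow> 1 \<le> r x" "\<And>x. x < N \<Longrightarrow> r x \<le> 1 / s"
      "\<And>x. x < N \<Longrightarrow> s\<^sup>2 * (\<Sum>y<N. variance_mat M N H $$ (x, y) * r y)
        \<le> row_norm (variance_mat M N H) * (1 - 1 / r x)"
    and small: "16 / \<epsilon>\<^sup>2 * (8 / real N) + 16 / \<epsilon>\<^sup>2 * real (2 * k) * ((Cs + 1) / real N) * (8 * real (2 * k) + 1)\<^sup>2
      + 4 / \<epsilon> * real (2 * k) * (sqrt (sqrt (real N)) / sqrt (real N)) * (8 * real (2 * k) + 1) * 8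
      \<le> (\<epsilon> / (16 * sqrt Cs + \<epsilon>)) / (1 + \<epsilon> / (16 * sqrt Cs + \<epsilon>))"
    and b: "sqrt (row_norm (variance_mat M N H)) / s + \<epsilon> \<le> b"
    and bias: "Cq 9 * (4 * sqrt Cs + \<epsilon>) \<le> sqrt (real N)"
  shows "measure M {\<omega>\<in>space M. \<bar>lambda_max (H \<omega>)\<bar> \<ge> b}
    \<le> (real N)\<^sup>2 * (Cq q / sqrt (sqrt (real N)) ^ q) + real N * 8 * (1 - (3 / 4) * \<epsilon> / (4 * sqrt Cs + \<epsilon>)) ^ (2 * k)"
proof -
  interpret prob_space M using wig by (simp add: wigner_type_def)
  define a where "a = sqrt (row_norm (variance_mat M N H)) / s"
  let ?R = "sqrt (real N)" and ?V = "variance_mat M N H"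
  let ?K = "sqrt ?R / ?R"
  have N0: "0 < N" and R1: "1 \<le> ?R" using N by simp_all
  have H: "H \<omega> \<in> carrier_mat N N" "mat_adjoint (H \<omega>) = H \<omega>" if "\<omega> \<in> space M" for \<omega>
    using wig that by (auto simp: wigner_type_def)
  have Hindep: "indep_vars (\<lambda>_. borel) (\<lambda>(x, y) \<omega>. H \<omega> $$ (x, y)) {(x, y). x \<le> y \<and> y < N}"
    using wig unfolding wigner_type_def by blast
  have Hsym: "H \<omega> $$ (y, x) = cnj (H \<omega> $$ (x, y))" if "\<omega> \<in> space M" "x < N" "y < N" for \<omega> x y
    using mat_adjoint_entry[OF H(1) that(3,2)] H(2) that(1) by simp
  have Hint: "integrable M (\<lambda>\<omega>. H \<omega> $$ (x, y))" "expectation (\<lambda>\<omega>. H \<omega> $$ (x, y)) = 0"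
    if "x < N" "y < N" for x y
    using cen that by (auto simp: centered_def)
  have Hmeas: "(\<lambda>\<omega>. H \<omega> $$ (x, y)) \<in> borel_measurable M" if "x < N" "y < N" for x y
    using Hint(1)[OF that] by (rule borel_measurable_integrable)
  have Hmom: "integrable M (\<lambda>\<omega>. (?R * cmod (H \<omega> $$ (x, y))) ^ q)"
    "(\<integral>\<omega>. (?R * cmod (H \<omega> $$ (x, y))) ^ q \<partial>M) \<le> Cq q" if "x < N" "y < N" for x y q
    using mom that by (auto simp: moment_bounds_def)
  have Cq0: "0 \<le> Cq q" for q
  proof -
    have "0 \<le> (\<integral>\<omega>. (?R * cmod (H \<omega> $$ (0, 0))) ^ q \<partial>M)" by (intro integral_nonneg_AE) auto
    then show ?thesis using Hmom(2)[OF N0 N0, of q] by linarith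
  qed
  have Hsq: "integrable M (\<lambda>\<omega>. (cmod (H \<omega> $$ (x, y)))\<^sup>2)" if "x < N" "y < N" for x y
  proof -
    have "integrable M (\<lambda>\<omega>. 1 / real N * (?R * cmod (H \<omega> $$ (x, y)))\<^sup>2)"
      using Hmom(1)[OF that, of 2] by simp
    then show ?thesis using N0 by (simp add: power_mult_distrib)
  qed
  have V: "?V $$ (x, y) = (\<integral>\<omega>. (cmod (H \<omega> $$ (x, y)))\<^sup>2 \<partial>M)" if "x < N" "y < N" for x y
    using that by (simp add: variance_mat_def)
  have Vc: "?V \<in> carrier_mat N N" by (rule variance_mat_carrier)
  have V0: "0 \<le> ?V $$ (x, y)" if "x < N" "y < N" for x y
    using that by (rule variance_mat_nonneg)
  have Vsym: "?V $$ (y, x) = ?V $$ (x, y)" if "x < N" "y < N" for x y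
    unfolding V[OF that] V[OF that(2,1)] 
    by (intro Bochner_Integration.integral_cong refl) (simp add: Hsym[OF _ that])
  define \<sigma>2 where "\<sigma>2 = row_norm ?V"
  have \<sigma>0: "0 \<le> \<sigma>2" unfolding \<sigma>2_def by (rule row_norm_nonneg[OF Vc N0])
  have \<sigma>C: "\<sigma>2 \<le> Cs"
    unfolding \<sigma>2_def using flat by (rule row_norm_variance_mat_le[OF N0])
  have s0: "0 < s" using s by simp
  have a0: "0 \<le> a" using \<sigma>0 s0 by (simp add: a_def \<sigma>2_def)
  have aC: "a \<le> 4 * sqrt Cs"
  proof -
    have "a \<le> sqrt Cs / (1 / 4)" unfolding a_def \<sigma>2_def[symmetric] using \<sigma>0 \<sigma>C s by (intro frac_le) auto
    then show ?thesis by simp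
  qed
  define \<theta> where "\<theta> = 1 / (a + \<epsilon> / 4)"
  have th: "0 < \<theta>" "\<theta> \<le> 4 / \<epsilon>" "1 / \<theta> \<le> 4 * sqrt Cs + \<epsilon>"
  proof -
    show "0 < \<theta>" using a0 \<epsilon> by (simp add: \<theta>_def add_nonneg_pos)
    have "1 / (a + \<epsilon> / 4) \<le> 1 / (\<epsilon> / 4)" using a0 \<epsilon> by (intro divide_left_mono mult_pos_pos add_nonneg_pos) auto
    then show "\<theta> \<le> 4 / \<epsilon>" by (simp add: \<theta>_def)
    show "1 / \<theta> \<le> 4 * sqrt Cs + \<epsilon>" using aC \<epsilon> by (simp add: \<theta>_def)
  qed
  define \<kappa> where "\<kappa> = \<epsilon> / (16 * sqrt Cs + \<epsilon>)"
  have den: "0 < 16 * sqrt Cs + \<epsilon>" using \<epsilon> Cs by (intro add_nonneg_pos) auto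
  have k: "0 < \<kappa>" "\<kappa> \<le> 1" using \<epsilon> Cs den by (simp_all add: \<kappa>_def)
  define u where "u x = (1 + \<kappa>) * r x" for x
  have u1: "1 \<le> u x" if "x < N" for x
  proof -
    have "1 * 1 \<le> (1 + \<kappa>) * r x" using k r(1)[OF that] by (intro mult_mono) auto
    then show ?thesis by (simp add: u_def)
  qed
  have u8: "u x \<le> 8" if "x < N" for x
  proof -
    have "1 / s \<le> 4" using s by (simp add: field_simps)
    then have "r x \<le> 4" using r(2)[OF that] by linarith
    then have "(1 + \<kappa>) * r x \<le> 2 * 4" using k r(1)[OF that] by (intro mult_mono) auto
    then show ?thesis by (simp add: u_def)
  qed
  \<comment> \<open>The summand \<open>1 / N\<^sup>2\<close> accounts for the means of the truncated entries.\<close>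
  define S where "S e = (if fst e < N \<and> snd e < N then ?V $$ e else 0) + 1 / (real N)\<^sup>2" for e
  have S0: "0 \<le> S e" for e
    using V0[of "fst e" "snd e"] by (auto simp: S_def)
  have Sc: "S e \<le> (Cs + 1) / real N" for e
  proof -
    have "1 / (real N)\<^sup>2 \<le> 1 / real N" using N0 by (simp add: power2_eq_square field_simps)
    moreover have "(if fst e < N \<and> snd e < N then ?V $$ e else 0) \<le> Cs / real N"
      using flat[of "fst e" "snd e"] Cs by auto
    ultimately show ?thesis by (simp add: S_def add_divide_distrib)
  qed
  have Sedge: "S (edge v y) = ?V $$ (v, y) + 1 / (real N)\<^sup>2" if "v < N" "y < N" for v y
    using that Vsym[OF that] by (auto simp: S_def edge_def min_def max_def)
  let ?n = "2 * k"
  let ?L = "8 * real ?n + 1" and ?c = "(Cs + 1) / real N"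
  have dyson: "1 / u v + \<theta>\<^sup>2 * (\<Sum>y<N. S (edge y v) * u y) + (\<theta>\<^sup>2 * real ?n * ?c * ?L\<^sup>2 + \<theta> * real ?n * ?K * ?L * 8) \<le> 1"
    if v: "v < N" for v
  proof -
    define T where "T = (\<Sum>y<N. ?V $$ (v, y) * r y)"
    have "(\<Sum>y<N. S (edge y v) * u y) = (\<Sum>y<N. ?V $$ (v, y) * u y + 1 / (real N)\<^sup>2 * u y)"
      using v by (intro sum.cong refl) (simp add: edge_commute[of _ v] Sedge distrib_right)
    also have "\<dots> = (1 + \<kappa>) * T + (\<Sum>y<N. 1 / (real N)\<^sup>2 * u y)"
      by (simp add: sum.distrib T_def u_def sum_distrib_left mult_ac)
    also have "(\<Sum>y<N. 1 / (real N)\<^sup>2 * u y) \<le> (\<Sum>y<N. 1 / (real N)\<^sup>2 * 8)"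
      using u8 by (intro sum_mono mult_left_mono) auto
    also have "\<dots> = 8 / real N" using N0 by (simp add: power2_eq_square)
    finally have sumS: "(\<Sum>y<N. S (edge y v) * u y) \<le> (1 + \<kappa>) * T + 8 / real N" by simp
    have th2: "\<theta>\<^sup>2 \<le> 16 / \<epsilon>\<^sup>2"
      using power_mono[OF th(2), of 2] th(1) by (simp add: power_divide)
    have main: "1 / u v + \<theta>\<^sup>2 * ((1 + \<kappa>) * T) \<le> 1 - \<kappa> / (1 + \<kappa>)"
      unfolding u_def \<kappa>_def \<theta>_def a_def
      using r(3)[OF v] unfolding \<sigma>2_def[symmetric] T_def[symmetric]
      by (intro scaled_supersolution_margin[OF \<epsilon> Cs \<sigma>0 \<sigma>C s r(1)[OF v]])
    have "\<theta>\<^sup>2 * (\<Sum>y<N. S (edge y v) * u y) \<le> \<theta>\<^sup>2 * ((1 + \<kappa>) * T + 8 / real N)"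
      using sumS by (intro mult_left_mono) auto
    also have "\<dots> = \<theta>\<^sup>2 * ((1 + \<kappa>) * T) + \<theta>\<^sup>2 * (8 / real N)" by (rule distrib_left)
    also have "\<theta>\<^sup>2 * (8 / real N) \<le> 16 / \<epsilon>\<^sup>2 * (8 / real N)" using th2 by (intro mult_right_mono) auto
    finally have b1: "\<theta>\<^sup>2 * (\<Sum>y<N. S (edge y v) * u y) \<le> \<theta>\<^sup>2 * ((1 + \<kappa>) * T) + 16 / \<epsilon>\<^sup>2 * (8 / real N)"
      by simp
    have b2: "\<theta>\<^sup>2 * real ?n * ?c * ?L\<^sup>2 \<le> 16 / \<epsilon>\<^sup>2 * real ?n * ?c * ?L\<^sup>2"
      using th2 Cs by (intro mult_right_mono) auto
    have b3: "\<theta> * real ?n * ?K * ?L * 8 \<le> 4 / \<epsilon> * real ?n * ?K * ?L * 8"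
      using th(2) by (intro mult_right_mono) auto
    show ?thesis using main b1 b2 b3 small unfolding \<kappa>_def by linarith
  qed
  define X where "X \<omega> x y = truncate_entry ?K (H \<omega> $$ (x, y))" for \<omega> x y
  have K0: "0 \<le> ?K" by simp
  have Xmeas: "(\<lambda>\<omega>. X \<omega> x y) \<in> borel_measurable M" if "x < N" "y < N" for x y
    unfolding X_def using Hmeas[OF that] by (rule measurable_compose) (rule truncate_entry_measurable)
  have Xindep: "indep_vars (\<lambda>_. borel) (\<lambda>(x, y) \<omega>. X \<omega> x y) {(x, y). x \<le> y \<and> y < N}"
  proof -
    have "indep_vars (\<lambda>_. borel) (\<lambda>e \<omega>. truncate_entry ?K ((\<lambda>(x, y) \<omega>. H \<omega> $$ (x, y)) e \<omega>)) {(x, y). x \<le> y \<and> y < N}"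
      by (rule indep_vars_compose2[OF Hindep]) (rule truncate_entry_measurable)
    then show ?thesis by (simp add: X_def case_prod_unfold)
  qed
  have Xherm: "X \<omega> y x = cnj (X \<omega> x y)" if "\<omega> \<in> space M" "x < N" "y < N" for \<omega> x y
    by (simp add: X_def truncate_entry_def Hsym[OF that])
  have Xbound: "cmod (X \<omega> x y) \<le> ?K" for \<omega> x y
    unfolding X_def by (rule norm_truncate_entry(1)[OF K0])
  have S_ge: "?V $$ (x, y) \<le> S (x, y)" "1 / (real N)\<^sup>2 \<le> S (x, y)" if "x < N" "y < N" for x y
    using that V0[OF that] by (simp_all add: S_def)
  have Xmean: "cmod (\<integral>\<omega>. X \<omega> x y \<partial>M) \<le> \<theta> * S (x, y)" if xy: "x \<le> y" "y < N" for x y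
  proof -
    have x: "x < N" using xy by simp
    have "cmod (\<integral>\<omega>. X \<omega> x y \<partial>M) \<le> Cq 9 / ?R ^ 5"
      unfolding X_def by (rule truncation_mean[OF Hint[OF x xy(2)] R1 Hmom[OF x xy(2)]])
    also have "\<dots> \<le> \<theta> * (1 / (real N)\<^sup>2)"
    proof -
      have "Cq 9 * (1 / \<theta>) \<le> Cq 9 * (4 * sqrt Cs + \<epsilon>)" using Cq0 th(3) by (intro mult_left_mono) auto
      then have "Cq 9 * (1 / \<theta>) \<le> ?R" using bias by linarith
      then have "Cq 9 \<le> \<theta> * ?R" using th(1) by (simp add: field_simps)
      moreover have "?R ^ 5 = ?R * (real N)\<^sup>2"
      proof -
        have "?R ^ 5 = ?R * (?R\<^sup>2)\<^sup>2" by (simp add: eval_nat_numeral mult_ac)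
        then show ?thesis by simp
      qed
      ultimately show ?thesis using N0 by (simp add: field_simps)
    qed
    also have "\<dots> \<le> \<theta> * S (x, y)" using th(1) S_ge(2)[OF x xy(2)] by (intro mult_left_mono) auto
    finally show ?thesis .
  qed
  have Xvar: "(\<integral>\<omega>. (cmod (X \<omega> x y))\<^sup>2 \<partial>M) \<le> S (x, y)" if xy: "x \<le> y" "y < N" for x y
  proof -
    have x: "x < N" using xy by simp
    note [measurable] = Xmeas[OF x xy(2)]
    have le: "(cmod (X \<omega> x y))\<^sup>2 \<le> (cmod (H \<omega> $$ (x, y)))\<^sup>2" for \<omega>
      unfolding X_def by (intro power_mono norm_truncate_entry(2)) auto
    have "(\<integral>\<omega>. (cmod (X \<omega> x y))\<^sup>2 \<partial>M) \<le> ?V $$ (x, y)"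
      unfolding V[OF x xy(2)]
    proof (rule integral_mono[OF _ Hsq[OF x xy(2)] le])
      show "integrable M (\<lambda>\<omega>. (cmod (X \<omega> x y))\<^sup>2)"
        using le by (intro Bochner_Integration.integrable_bound[OF Hsq[OF x xy(2)]]) auto
    qed
    also have "\<dots> \<le> S (x, y)" by (rule S_ge(1)[OF x xy(2)])
    finally show ?thesis .
  qed
  let ?F = "\<lambda>\<omega>. frobenius_pow N k (X \<omega>)"
  have Fint: "integrable M ?F" and FE0: "expectation ?F \<le> (\<Sum>p\<in>walks N ?n. walk_weight \<theta> ?K S p)"
    by (rule expectation_frobenius_pow[OF Xindep Xherm Xbound Xmean Xvar th(1) K0 S0]; assumption)+
  have "(\<Sum>p\<in>walks N ?n. walk_weight \<theta> ?K S p) \<le> real N * 8 * (1 / \<theta>) ^ ?n"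
  proof (rule sum_walk_weight_le[where n = ?n and L = ?L and c = ?c and u = u])
    show "0 \<le> ?c" using Cs by simp
  qed (use th K0 S0 Sc u1 u8 dyson in auto)
  then have FE: "expectation ?F \<le> real N * 8 * (a + \<epsilon> / 4) ^ ?n" using FE0 by (simp add: \<theta>_def)
  have ae: "0 < a + \<epsilon>" using a0 \<epsilon> by simp
  define G where "G = {\<omega>\<in>space M. (a + \<epsilon>) ^ ?n \<le> ?F \<omega>}"
  have G: "G \<in> events" unfolding G_def using borel_measurable_integrable[OF Fint] by measurable
  have "prob G \<le> expectation ?F / (a + \<epsilon>) ^ ?n"
    unfolding G_def using ae
    by (intro integral_Markov_inequality_measure[OF Fint, of "{}"]) (auto simp: frobenius_pow_def intro!: sum_nonneg)
  also have "\<dots> \<le> real N * 8 * (a + \<epsilon> / 4) ^ ?n / (a + \<epsilon>) ^ ?n"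
    using FE ae by (intro divide_right_mono) auto
  also have "\<dots> = real N * 8 * ((a + \<epsilon> / 4) / (a + \<epsilon>)) ^ ?n" by (simp add: power_divide)
  also have "\<dots> \<le> real N * 8 * (1 - (3 / 4) * \<epsilon> / (4 * sqrt Cs + \<epsilon>)) ^ ?n"
  proof (intro mult_left_mono power_mono)
    have "(a + \<epsilon> / 4) / (a + \<epsilon>) = 1 - (3 / 4) * \<epsilon> / (a + \<epsilon>)" using ae by (simp add: field_simps)
    also have "(3 / 4) * \<epsilon> / (4 * sqrt Cs + \<epsilon>) \<le> (3 / 4) * \<epsilon> / (a + \<epsilon>)"
      using ae aC \<epsilon> by (intro divide_left_mono mult_pos_pos) auto
    then have "1 - (3 / 4) * \<epsilon> / (a + \<epsilon>) \<le> 1 - (3 / 4) * \<epsilon> / (4 * sqrt Cs + \<epsilon>)" by simp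
    finally show "(a + \<epsilon> / 4) / (a + \<epsilon>) \<le> 1 - (3 / 4) * \<epsilon> / (4 * sqrt Cs + \<epsilon>)" .
    show "0 \<le> (a + \<epsilon> / 4) / (a + \<epsilon>)" using a0 \<epsilon> by simp
  qed simp
  finally have pG: "prob G \<le> real N * 8 * (1 - (3 / 4) * \<epsilon> / (4 * sqrt Cs + \<epsilon>)) ^ ?n" .
  define B where "B e = {\<omega>\<in>space M. ?K < cmod (H \<omega> $$ e)}" for e
  let ?I = "{..<N} \<times> {..<N}"
  have B: "B e \<in> events" if "e \<in> ?I" for e
    using Hmeas[of "fst e" "snd e"] that unfolding B_def by auto
  have pB: "prob (B e) \<le> Cq q / sqrt ?R ^ q" if eI: "e \<in> ?I" for e
  proof -
    obtain x y where e: "e = (x, y)" "x < N" "y < N" using eI by (cases e) auto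
    show ?thesis unfolding B_def e(1) by (rule truncation_tail[OF R1 Hmom[OF e(2,3)] Hmeas[OF e(2,3)]])
  qed
  have "prob (\<Union>e\<in>?I. B e) \<le> (\<Sum>e\<in>?I. prob (B e))" using B by (intro finite_measure_subadditive_finite) auto
  also have "\<dots> \<le> (\<Sum>e\<in>?I. Cq q / sqrt ?R ^ q)" by (intro sum_mono pB)
  also have "\<dots> = (real N)\<^sup>2 * (Cq q / sqrt ?R ^ q)" by (simp add: power2_eq_square)
  finally have pUB: "prob (\<Union>e\<in>?I. B e) \<le> (real N)\<^sup>2 * (Cq q / sqrt ?R ^ q)" .
  have "{\<omega>\<in>space M. \<bar>lambda_max (H \<omega>)\<bar> \<ge> b} \<subseteq> (\<Union>e\<in>?I. B e) \<union> G"
  proof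
    fix \<omega> assume w: "\<omega> \<in> {\<omega>\<in>space M. \<bar>lambda_max (H \<omega>)\<bar> \<ge> b}"
    then have sp: "\<omega> \<in> space M" and l: "a + \<epsilon> \<le> \<bar>lambda_max (H \<omega>)\<bar>"
      using b by (auto simp: a_def)
    show "\<omega> \<in> (\<Union>e\<in>?I. B e) \<union> G"
    proof (cases "\<omega> \<in> (\<Union>e\<in>?I. B e)")
      case False
      have XH: "X \<omega> x y = H \<omega> $$ (x, y)" if "x < N" "y < N" for x y
        using False sp that by (auto simp: X_def truncate_entry_def B_def not_less)
      obtain v x0 where v: "\<And>x. x < N \<Longrightarrow> (\<Sum>y<N. H \<omega> $$ (x, y) * v y) = complex_of_real (lambda_max (H \<omega>)) * v x"
        "x0 < N" "v x0 \<noteq> 0"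
        using lambda_max_eigenvector[OF H[OF sp] N0] by blast
      have "lambda_max (H \<omega>) ^ (2 * k) \<le> ?F \<omega>"
      proof (rule eigenvalue_pow_le_frobenius_pow[of N "X \<omega>" v "lambda_max (H \<omega>)" x0 k])
        fix x assume x: "x < N"
        have "(\<Sum>y<N. X \<omega> x y * v y) = (\<Sum>y<N. H \<omega> $$ (x, y) * v y)"
          using XH[OF x] by (intro sum.cong refl) simp
        then show "(\<Sum>y<N. X \<omega> x y * v y) = complex_of_real (lambda_max (H \<omega>)) * v x" using v(1)[OF x] by simp
      qed (fact v)+
      moreover have "(a + \<epsilon>) ^ ?n \<le> \<bar>lambda_max (H \<omega>)\<bar> ^ ?n" using l ae by (intro power_mono) auto
      moreover have "\<bar>lambda_max (H \<omega>)\<bar> ^ ?n = lambda_max (H \<omega>) ^ ?n" by (simp add: power_even_abs)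
      ultimately have "\<omega> \<in> G" using sp by (simp add: G_def)
      then show ?thesis by simp
    qed simp
  qed
  then have "prob {\<omega>\<in>space M. \<bar>lambda_max (H \<omega>)\<bar> \<ge> b} \<le> prob ((\<Union>e\<in>?I. B e) \<union> G)"
    using B G by (intro finite_measure_mono) auto
  also have "\<dots> \<le> prob (\<Union>e\<in>?I. B e) + prob G"
    using B G by (intro measure_Un_le) auto
  finally show ?thesis using pG pUB by linarith
qed

text \<open>
  The error terms of the moment method are polynomial in the order \<open>2k\<close> of the moment, divided by a power of
  \<open>N\<close>; hence they vanish when \<open>k\<close> is of order \<open>log N\<close>.
\<close>
lemma eventually_moment_order_small:
  fixes A \<epsilon> Cs \<delta> :: real
  assumes "0 < A" "0 < \<epsilon>" "0 \<le> Cs" "0 < \<delta>"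
  shows "\<forall>\<^sub>F N in sequentially. 16 / \<epsilon>\<^sup>2 * (8 / real N)
      + 16 / \<epsilon>\<^sup>2 * (2 * (A * ln (real N) + 1)) * ((Cs + 1) / real N) * (8 * (2 * (A * ln (real N) + 1)) + 1)\<^sup>2
      + 4 / \<epsilon> * (2 * (A * ln (real N) + 1)) * (sqrt (sqrt (real N)) / sqrt (real N)) * (8 * (2 * (A * ln (real N) + 1)) + 1) * 8
      \<le> \<delta>"
proof -
  have "((\<lambda>N::nat. 16 / \<epsilon>\<^sup>2 * (8 / real N)
      + 16 / \<epsilon>\<^sup>2 * (2 * (A * ln (real N) + 1)) * ((Cs + 1) / real N) * (8 * (2 * (A * ln (real N) + 1)) + 1)\<^sup>2
      + 4 / \<epsilon> * (2 * (A * ln (real N) + 1)) * (sqrt (sqrt (real N)) / sqrt (real N)) * (8 * (2 * (A * ln (real N) + 1)) + 1) * 8)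
    \<longlongrightarrow> 0) sequentially"
    using assms by real_asymp
  then have "\<forall>\<^sub>F N::nat in sequentially. 16 / \<epsilon>\<^sup>2 * (8 / real N)
      + 16 / \<epsilon>\<^sup>2 * (2 * (A * ln (real N) + 1)) * ((Cs + 1) / real N) * (8 * (2 * (A * ln (real N) + 1)) + 1)\<^sup>2
      + 4 / \<epsilon> * (2 * (A * ln (real N) + 1)) * (sqrt (sqrt (real N)) / sqrt (real N)) * (8 * (2 * (A * ln (real N) + 1)) + 1) * 8
      < \<delta>" using assms(4) by (rule order_tendstoD(2))
  then show ?thesis by (rule eventually_mono) simp
qed

text \<open>
  A power \<open>2k\<close> with \<open>k\<close> of order \<open>log N\<close> turns the fixed ratio \<open>g < 1\<close> between the growth rate of
  the trace and the threshold into \<open>N^(-D - 1)\<close>; one factor \<open>N\<close> is lost to the trace.  For the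
  finitely many \<open>N\<close> below the point where the asymptotics set in, the constant makes the bound trivial.
\<close>
lemma lambda_max_tail_uniform:
  fixes Cs \<epsilon> D :: real and Cq :: "nat \<Rightarrow> real"
  assumes \<epsilon>: "0 < \<epsilon>" and D: "0 < D"
  shows "\<exists>C. \<forall>(M :: 'a measure) N H s r b. 1 \<le> N \<and> wigner_type M N H \<and> centered M N H \<and> moment_bounds M N H Cq \<and>
    (\<forall>x<N. \<forall>y<N. variance_mat M N H $$ (x, y) \<le> Cs / real N) \<and> 1 / 4 \<le> s \<and>
    (\<forall>x<N. 1 \<le> r x \<and> r x \<le> 1 / s \<and> s\<^sup>2 * (\<Sum>y<N. variance_mat M N H $$ (x, y) * r y)
        \<le> row_norm (variance_mat M N H) * (1 - 1 / r x)) \<and>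
    sqrt (row_norm (variance_mat M N H)) / s + \<epsilon> \<le> b \<longrightarrow>
    measure M {\<omega>\<in>space M. \<bar>lambda_max (H \<omega>)\<bar> \<ge> b}
      \<le> C * real N powr (- D)"
proof (cases "0 \<le> Cs")
  case False
  have "\<not> (\<forall>x<N. \<forall>y<N. variance_mat M N H $$ (x, y) \<le> Cs / real N)" if "1 \<le> N" for M :: "'a measure" and N H
  proof -
    have "Cs / real N < 0" using False that by (simp add: divide_neg_pos)
    moreover have "0 \<le> variance_mat M N H $$ (0, 0)" using that by (intro variance_mat_nonneg) auto
    moreover have "0 < N" using that by simp
    ultimately show ?thesis by (meson not_less order_less_le_trans)
  qed
  then show ?thesis by (intro exI[of _ 0] allI impI) blast
next
  case Cs: True
  define g where "g = 1 - (3 / 4) * \<epsilon> / (4 * sqrt Cs + \<epsilon>)"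
  have den: "0 < 4 * sqrt Cs + \<epsilon>" "\<epsilon> \<le> 4 * sqrt Cs + \<epsilon>"
  proof -
    show "0 < 4 * sqrt Cs + \<epsilon>" using Cs \<epsilon> by (intro add_nonneg_pos) simp_all
    show "\<epsilon> \<le> 4 * sqrt Cs + \<epsilon>" using Cs by simp
  qed
  have g: "0 < g" "g < 1"
  proof -
    have "(3 / 4) * (\<epsilon> / (4 * sqrt Cs + \<epsilon>)) \<le> (3 / 4) * 1"
      using divide_le_eq_1_pos[OF den(1)] den(2) by (intro mult_left_mono) simp_all
    then show "0 < g" by (simp add: g_def)
    have "0 < (3 / 4) * \<epsilon> / (4 * sqrt Cs + \<epsilon>)" by (intro divide_pos_pos mult_pos_pos den(1) \<epsilon>) simp_all
    then show "g < 1" by (simp add: g_def)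
  qed
  define A where "A = (D + 1) / (- 2 * ln g)"
  have lng: "ln g < 0" using g by simp
  have A: "0 < A" unfolding A_def using D lng by (intro divide_pos_pos) auto
  define \<delta> where "\<delta> = (\<epsilon> / (16 * sqrt Cs + \<epsilon>)) / (1 + \<epsilon> / (16 * sqrt Cs + \<epsilon>))"
  have den16: "0 < 16 * sqrt Cs + \<epsilon>" using \<epsilon> Cs by (intro add_nonneg_pos) auto
  note frac_pos = divide_pos_pos[OF \<epsilon> den16]
  have "0 < 1 + \<epsilon> / (16 * sqrt Cs + \<epsilon>)" using frac_pos by linarith
  then have \<delta>: "0 < \<delta>" unfolding \<delta>_def by (rule divide_pos_pos[OF frac_pos])
  have "filterlim (\<lambda>N::nat. sqrt (real N)) at_top sequentially" by real_asymp
  then have "\<forall>\<^sub>F N::nat in sequentially. Cq 9 * (4 * sqrt Cs + \<epsilon>) \<le> sqrt (real N)"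
    by (simp only: filterlim_at_top)
  from eventually_conj[OF eventually_moment_order_small[OF A \<epsilon> Cs \<delta>] this]
  obtain N1 where N1: "\<And>N. N1 \<le> N \<Longrightarrow> 16 / \<epsilon>\<^sup>2 * (8 / real N)
      + 16 / \<epsilon>\<^sup>2 * (2 * (A * ln (real N) + 1)) * ((Cs + 1) / real N) * (8 * (2 * (A * ln (real N) + 1)) + 1)\<^sup>2
      + 4 / \<epsilon> * (2 * (A * ln (real N) + 1)) * (sqrt (sqrt (real N)) / sqrt (real N)) * (8 * (2 * (A * ln (real N) + 1)) + 1) * 8
      \<le> \<delta>" "\<And>N. N1 \<le> N \<Longrightarrow> Cq 9 * (4 * sqrt Cs + \<epsilon>) \<le> sqrt (real N)"
    unfolding eventually_sequentially by blast
  define q where "q = nat \<lceil>4 * (D + 2)\<rceil>"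
  have q: "4 * (D + 2) \<le> real q" unfolding q_def by linarith
  define C where "C = \<bar>Cq q\<bar> + 8 + real N1 powr D"
  have main: "measure M {\<omega>\<in>space M. \<bar>lambda_max (H \<omega>)\<bar> \<ge> b}
      \<le> C * real N powr (- D)"
    if N: "1 \<le> N" and wig: "wigner_type M N H" and cen: "centered M N H" and mom: "moment_bounds M N H Cq"
    and flat: "\<And>x y. x < N \<Longrightarrow> y < N \<Longrightarrow> variance_mat M N H $$ (x, y) \<le> Cs / real N"
    and s: "1 / 4 \<le> s" and r: "\<And>x. x < N \<Longrightarrow> 1 \<le> r x" "\<And>x. x < N \<Longrightarrow> r x \<le> 1 / s"
      "\<And>x. x < N \<Longrightarrow> s\<^sup>2 * (\<Sum>y<N. variance_mat M N H $$ (x, y) * r y)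
        \<le> row_norm (variance_mat M N H) * (1 - 1 / r x)"
    and b: "sqrt (row_norm (variance_mat M N H)) / s + \<epsilon> \<le> b"
    for M :: "'a measure" and N H s r b
  proof -
    interpret prob_space M using wig by (simp add: wigner_type_def)
    let ?ev = "{\<omega>\<in>space M. \<bar>lambda_max (H \<omega>)\<bar> \<ge> b}"
    have C_ge: "\<bar>Cq q\<bar> + 8 \<le> C" "real N1 powr D \<le> C" by (simp_all add: C_def)
    show ?thesis
    proof (cases "N1 \<le> N")
      case False
      have "1 = real N powr D * real N powr (- D)" using N by (simp add: powr_add[symmetric])
      also have "real N powr D \<le> real N1 powr D" using False D by (intro powr_mono2) auto
      also have "real N1 powr D \<le> C" by (rule C_ge)
      finally have "1 \<le> C * real N powr (- D)" by (simp add: mult_right_mono)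
      then show ?thesis using prob_le_1[of ?ev] by linarith
    next
      case True
      define k where "k = nat \<lceil>A * ln (real N)\<rceil>"
      have lnN: "0 \<le> ln (real N)" using N by simp
      have k: "A * ln (real N) \<le> real k" "real k \<le> A * ln (real N) + 1"
        using A lnN by (simp_all add: k_def)
      define b where "b = 2 * (A * ln (real N) + 1)"
      have kb: "real (2 * k) \<le> b" using k by (simp add: b_def)
      have small: "16 / \<epsilon>\<^sup>2 * (8 / real N) + 16 / \<epsilon>\<^sup>2 * real (2 * k) * ((Cs + 1) / real N) * (8 * real (2 * k) + 1)\<^sup>2
        + 4 / \<epsilon> * real (2 * k) * (sqrt (sqrt (real N)) / sqrt (real N)) * (8 * real (2 * k) + 1) * 8 \<le> \<delta>"
      proof -
        have "16 / \<epsilon>\<^sup>2 * real (2 * k) * ((Cs + 1) / real N) * (8 * real (2 * k) + 1)\<^sup>2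
            \<le> 16 / \<epsilon>\<^sup>2 * b * ((Cs + 1) / real N) * (8 * b + 1)\<^sup>2"
          using kb Cs by (intro mult_mono power_mono mult_nonneg_nonneg) auto
        moreover have "4 / \<epsilon> * real (2 * k) * (sqrt (sqrt (real N)) / sqrt (real N)) * (8 * real (2 * k) + 1) * 8
            \<le> 4 / \<epsilon> * b * (sqrt (sqrt (real N)) / sqrt (real N)) * (8 * b + 1) * 8"
          using kb \<epsilon> by (intro mult_mono mult_nonneg_nonneg) auto
        ultimately show ?thesis using N1(1)[OF True] unfolding b_def[symmetric] by linarith
      qed
      have "prob ?ev \<le> (real N)\<^sup>2 * (Cq q / sqrt (sqrt (real N)) ^ q) + real N * 8 * g ^ (2 * k)"
        unfolding g_def
        by (rule lambda_max_tail_bound[OF N wig cen mom flat \<epsilon> Cs s r small[unfolded \<delta>_def] b N1(2)[OF True]])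
      also have "(real N)\<^sup>2 * (Cq q / sqrt (sqrt (real N)) ^ q) \<le> \<bar>Cq q\<bar> * real N powr (- D)"
      proof -
        have root: "sqrt (sqrt (real N)) ^ q = real N powr (real q / 4)"
        proof -
          have "sqrt (sqrt (real N)) = real N powr (1 / 4)"
            using N by (simp add: powr_half_sqrt[symmetric] powr_powr)
          then show ?thesis using N by (simp add: powr_powr powr_realpow[symmetric])
        qed
        have "(real N)\<^sup>2 * (Cq q / sqrt (sqrt (real N)) ^ q) \<le> \<bar>Cq q\<bar> * ((real N)\<^sup>2 / sqrt (sqrt (real N)) ^ q)"
          using N by (simp add: mult.commute divide_right_mono mult_right_mono)
        also have "(real N)\<^sup>2 / sqrt (sqrt (real N)) ^ q = real N powr (2 - real q / 4)"
          unfolding root using N by (simp add: powr_diff)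
        also have "real N powr (2 - real q / 4) \<le> real N powr (- D)"
          using N q by (intro powr_mono) auto
        finally show ?thesis by (simp add: mult_left_mono)
      qed
      also have "real N * 8 * g ^ (2 * k) \<le> 8 * real N powr (- D)"
      proof -
        have "g ^ (2 * k) = exp (real (2 * k) * ln g)"
          using g by (simp add: exp_of_nat_mult del: of_nat_mult)
        also have "\<dots> \<le> exp (2 * (A * ln (real N)) * ln g)"
          using k(1) lng by (simp add: mult_right_mono_neg)
        also have "2 * (A * ln (real N)) * ln g = - (D + 1) * ln (real N)"
          using lng by (simp add: A_def) (simp add: algebra_simps)
        also have "exp (- (D + 1) * ln (real N)) = real N powr (- (D + 1))"
          using N by (simp add: powr_def)
        finally have "real N * 8 * g ^ (2 * k) \<le> real N * 8 * real N powr (- (D + 1))"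
          by (intro mult_left_mono) auto
        also have "real N * 8 * real N powr (- (D + 1)) = 8 * (real N powr 1 * real N powr (- (D + 1)))"
          using N by simp
        also have "real N powr 1 * real N powr (- (D + 1)) = real N powr (- D)"
          unfolding powr_add[symmetric] by simp
        finally show ?thesis .
      qed
      also have "\<bar>Cq q\<bar> * real N powr (- D) + 8 * real N powr (- D) \<le> C * real N powr (- D)"
        unfolding distrib_right[symmetric] using C_ge(1) by (intro mult_right_mono) auto
      finally show ?thesis by simp
    qed
  qed
  show ?thesis
  proof (intro exI[of _ C] allI impI, elim conjE)
    fix M :: "'a measure" and N H s r b
    assume "1 \<le> N" "wigner_type M N H" "centered M N H" "moment_bounds M N H Cq"
      "\<forall>x<N. \<forall>y<N. variance_mat M N H $$ (x, y) \<le> Cs / real N" "1 / 4 \<le> s"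
      "\<forall>x<N. 1 \<le> r x \<and> r x \<le> 1 / s \<and> s\<^sup>2 * (\<Sum>y<N. variance_mat M N H $$ (x, y) * r y)
        \<le> row_norm (variance_mat M N H) * (1 - 1 / r x)"
      "sqrt (row_norm (variance_mat M N H)) / s + \<epsilon> \<le> b"
    then show "measure M {\<omega>\<in>space M. \<bar>lambda_max (H \<omega>)\<bar> \<ge> b}
      \<le> C * real N powr (- D)"
      by (intro main[of N M H s r b]) blast+
  qed
qed

theorem corollary1p2:
  shows "\<exists>C :: real \<Rightarrow> (nat \<Rightarrow> real) \<Rightarrow> real \<Rightarrow> real \<Rightarrow> real.
    \<forall>(S :: nat \<Rightarrow> real mat) \<epsilon>. \<epsilon> > 0 \<longrightarrow> (\<exists>N\<^sub>0.
      \<forall>(M :: nat \<Rightarrow> 'a measure) (H :: nat \<Rightarrow> 'a \<Rightarrow> complex mat) Cstar Cq.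
        (\<forall>N\<ge>1. wigner_type (M N) N (H N) \<and> centered (M N) N (H N) \<and>
               S N = variance_mat (M N) N (H N) \<and>
               (\<forall>x<N. \<forall>y<N. S N $$ (x, y) \<le> Cstar / real N) \<and>
               moment_bounds (M N) N (H N) Cq) \<longrightarrow>
        (\<forall>(J :: enat) D N. D > 0 \<and> N \<ge> 1 \<and> N \<ge> N\<^sub>0 \<longrightarrow>
           measure (M N) {\<omega> \<in> space (M N).
               \<bar>lambda_max (H N \<omega>)\<bar> \<ge> 2 * sqrt (row_norm (S N)) / w_c (zcoef S) J + \<epsilon>}
             \<le> C Cstar Cq \<epsilon> D * real N powr (- D)))"
proof -
  define P where "P = (\<lambda>C Cs Cq \<epsilon> D. \<forall>(M :: 'a measure) N H s r b. 1 \<le> N \<and> wigner_type M N H \<and> centered M N H \<and> moment_bounds M N H Cq \<and>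
    (\<forall>x<N. \<forall>y<N. variance_mat M N H $$ (x, y) \<le> Cs / real N) \<and> 1 / 4 \<le> s \<and>
    (\<forall>x<N. 1 \<le> r x \<and> r x \<le> 1 / s \<and> s\<^sup>2 * (\<Sum>y<N. variance_mat M N H $$ (x, y) * r y)
        \<le> row_norm (variance_mat M N H) * (1 - 1 / r x)) \<and>
    sqrt (row_norm (variance_mat M N H)) / s + \<epsilon> \<le> b \<longrightarrow>
    measure M {\<omega>\<in>space M. \<bar>lambda_max (H \<omega>)\<bar> \<ge> b}
      \<le> C * real N powr (- D))"
  define C where "C Cs Cq \<epsilon> D = (SOME c. P c Cs Cq (\<epsilon> / 2) D)" for Cs Cq \<epsilon> D
  have C: "P (C Cs Cq \<epsilon> D) Cs Cq (\<epsilon> / 2) D" if "0 < \<epsilon>" "0 < D" for Cs Cq \<epsilon> D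
    unfolding C_def
    by (rule someI_ex, unfold P_def, rule lambda_max_tail_uniform) (use that in auto)
  show ?thesis
  proof (intro exI[of _ C] allI impI)
    fix S :: "nat \<Rightarrow> real mat" and \<epsilon> :: real
    assume \<epsilon>: "0 < \<epsilon>"
    define good where "good B \<longleftrightarrow> (\<forall>N\<ge>1. S N \<in> carrier_mat N N \<and> (\<forall>x<N. \<forall>y<N. 0 \<le> S N $$ (x, y)) \<and> row_norm (S N) \<le> B)"
      for B
    define Q where "Q N \<longleftrightarrow> (\<exists>s r. 1 / 4 \<le> s \<and>
      (\<forall>x<N. 1 \<le> r x \<and> r x \<le> 1 / s \<and> s\<^sup>2 * (\<Sum>y<N. S N $$ (x, y) * r y) \<le> row_norm (S N) * (1 - 1 / r x)) \<and>
      (\<forall>J. sqrt (row_norm (S N)) / s \<le> 2 * sqrt (row_norm (S N)) / w_c (zcoef S) J + \<epsilon> / 2))" for N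
    \<comment> \<open>The threshold has to be chosen before the ensemble is known; if the norms of \<open>S\<close> are unbounded,
      or \<open>S\<close> is not a sequence of nonnegative matrices, it is the variance matrix of no admissible ensemble.\<close>
    have "\<exists>N\<^sub>0. (\<exists>B. good B) \<longrightarrow> (\<forall>N\<ge>N\<^sub>0. 1 \<le> N \<longrightarrow> Q N)"
    proof (cases "\<exists>B. good B")
      case True
      then obtain B where "good B" by blast
      then have "\<exists>N\<^sub>0. \<forall>N\<ge>N\<^sub>0. 1 \<le> N \<longrightarrow> Q N"
        unfolding Q_def using \<epsilon> by (intro eventually_supersolution[of S B "\<epsilon> / 2"]) (auto simp: good_def)
      then show ?thesis by blast
    qed blast
    then obtain N\<^sub>0 where N\<^sub>0: "\<And>B N. good B \<Longrightarrow> N\<^sub>0 \<le> N \<Longrightarrow> 1 \<le> N \<Longrightarrow> Q N" by blast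
    show "\<exists>N\<^sub>0. \<forall>(M :: nat \<Rightarrow> 'a measure) (H :: nat \<Rightarrow> 'a \<Rightarrow> complex mat) Cstar Cq.
        (\<forall>N\<ge>1. wigner_type (M N) N (H N) \<and> centered (M N) N (H N) \<and>
               S N = variance_mat (M N) N (H N) \<and>
               (\<forall>x<N. \<forall>y<N. S N $$ (x, y) \<le> Cstar / real N) \<and>
               moment_bounds (M N) N (H N) Cq) \<longrightarrow>
        (\<forall>(J :: enat) D N. D > 0 \<and> N \<ge> 1 \<and> N \<ge> N\<^sub>0 \<longrightarrow>
           measure (M N) {\<omega> \<in> space (M N).
               \<bar>lambda_max (H N \<omega>)\<bar> \<ge> 2 * sqrt (row_norm (S N)) / w_c (zcoef S) J + \<epsilon>}
             \<le> C Cstar Cq \<epsilon> D * real N powr (- D))"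
    proof (intro exI[of _ N\<^sub>0] allI impI, elim conjE)
      fix M :: "nat \<Rightarrow> 'a measure" and H :: "nat \<Rightarrow> 'a \<Rightarrow> complex mat" and Cstar Cq J and D :: real and N
      assume hyp: "\<forall>N\<ge>1. wigner_type (M N) N (H N) \<and> centered (M N) N (H N) \<and>
               S N = variance_mat (M N) N (H N) \<and>
               (\<forall>x<N. \<forall>y<N. S N $$ (x, y) \<le> Cstar / real N) \<and>
               moment_bounds (M N) N (H N) Cq"
        and D: "0 < D" and N: "1 \<le> N" "N\<^sub>0 \<le> N"
      have "good Cstar"
        unfolding good_def
      proof (intro allI impI)
        fix n :: nat assume n: "1 \<le> n"
        have V: "S n = variance_mat (M n) n (H n)" "\<forall>x<n. \<forall>y<n. S n $$ (x, y) \<le> Cstar / real n"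
          using hyp n by blast+
        have "row_norm (variance_mat (M n) n (H n)) \<le> Cstar"
          using n V(2) unfolding V(1) by (intro row_norm_variance_mat_le) auto
        then show "S n \<in> carrier_mat n n \<and> (\<forall>x<n. \<forall>y<n. 0 \<le> S n $$ (x, y)) \<and> row_norm (S n) \<le> Cstar"
          unfolding V(1) by (simp add: variance_mat_carrier variance_mat_nonneg)
      qed
      then have "Q N" using N\<^sub>0 N by blast
      then obtain s r where sr: "1 / 4 \<le> s"
        "\<forall>x<N. 1 \<le> r x \<and> r x \<le> 1 / s \<and> s\<^sup>2 * (\<Sum>y<N. S N $$ (x, y) * r y) \<le> row_norm (S N) * (1 - 1 / r x)"
        "\<forall>J. sqrt (row_norm (S N)) / s \<le> 2 * sqrt (row_norm (S N)) / w_c (zcoef S) J + \<epsilon> / 2"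
        unfolding Q_def by blast
      have W: "wigner_type (M N) N (H N)" "centered (M N) N (H N)" "moment_bounds (M N) N (H N) Cq"
        "S N = variance_mat (M N) N (H N)" "\<forall>x<N. \<forall>y<N. S N $$ (x, y) \<le> Cstar / real N"
        using hyp N(1) by blast+
      let ?b = "2 * sqrt (row_norm (S N)) / w_c (zcoef S) J + \<epsilon>"
      have "sqrt (row_norm (S N)) / s + \<epsilon> / 2 \<le> ?b" using spec[OF sr(3), of J] by linarith
      with C[OF \<epsilon> D, of Cstar Cq] N(1) W(1-3,5) sr(1,2)
      show "measure (M N) {\<omega> \<in> space (M N). \<bar>lambda_max (H N \<omega>)\<bar> \<ge> ?b}
          \<le> C Cstar Cq \<epsilon> D * real N powr (- D)"
        unfolding P_def W(4) by blast
    qed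
  qed
qed

end
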